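(* Let $P\subset\mathbb{R}^N_{>0}$ be a finite nonempty set of $n$ points and let $a\in\mathbb{R}^N_{>0}$ satisfy $a_i\ge p_i$ for all $p\in P$ and all $i$. Suppose $U(b(P))$ is decomposed into $M$ disjoint axis-aligned boxes in time $T_{\rm decomp}(n,M,N)$. Then the perspective algorithm described in the context computes the absolute integral $R_2(P)$ in $$T_{\rm decomp}(n,M,N)+O(NM+2^NM)$$ time, and in $O(M)$ space if the decomposition is stored. For fixed $N$, the time is $T_{\rm decomp}(n,M,N)+O(M)$.
   Context: $\Delta_{N-1}=\{w\in\mathbb{R}^N_{\ge0}:w_1+\cdots+w_N=1\}$ with measure $dw=dw_1\cdots dw_{N-1}$; $g_p(w)=\max_iw_ip_i$; $\tau_P(w)=\min_{p\in P}g_p(w)$; $R_2(P)=\int_{\Delta_{N-1}}\tau_P(w)\,dw$. For $p\in\mathbb{R}^N_{>0}$, $b(p)=(1/p_1,\ldots,1/p_N)$, $b(P)=\{b(p):p\in P\}$, and $U(Q)=\bigcup_{q\in Q}\prod_{i=1}^N[0,q_i]$ for $Q\subset\mathbb{R}^N_{>0}$. "Disjoint" boxes means boxes with pairwise disjoint interiors. Weighted box integral: for a box $C=\prod_{i=1}^N[\ell_i,u_i]\subset\mathbb{R}_{\ge0}^N$ not containing the origin (infinite $u_i$ allowed), $\mu_N(C)=\int_C (x_1+\cdots+x_N)^{-(N+1)}dx$, evaluated by the $2^N$-corner formula $\mu_N(C)=\frac1{N!}\sum_{\epsilon\in\{0,1\}^N}(-1)^{|\epsilon|}\frac{1}{x_1^{\epsilon_1}+\cdots+x_N^{\epsilon_N}}$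 with $x_i^0=\ell_i$, $x_i^1=u_i$, and terms with an infinite coordinate equal to zero. Perspective algorithm. Input: $N$, $P$, $a$, and a routine returning a decomposition of $U(b(P))$ into disjoint axis-aligned boxes. (1) Set $u=b(a)$ and $A=\prod_i[0,u_i]$. (2) Let $R_a$ be the integral of $(x_1+\cdots+x_N)^{-(N+1)}$ over $\mathbb{R}^N_{>0}\setminus A$, computed as the sum of $\mu_N$ over the $N$ semi-infinite boxes $[0,u_1]\times\cdots\times[0,u_{k-1}]\times[u_k,\infty)\times[0,\infty)^{N-k}$, $k=1,\ldots,N$. (3) Obtain the box decomposition $\mathcal{D}$ of $U(b(P))$ with $M=|\mathcal D|$ boxes, and set $I=0$. (4) For each $Q\in\mathcal{D}$, decompose $Q\setminus A$ into disjoint axis-aligned boxes by a slab decomposition, and for each resulting box $C$ add $\mu_N(C)$ to $I$. (5) Return $R_a-I$. Time is counted in exact real arithmetic operations.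
   Formalization: The bound O(NM+2^N M) uniform in N is shown for the algorithm with corner terms cancelling between slabs of the same Q skipped; with the full 2^N-corner formula on each slab it fails, so that version is shown only for fixed N. O(M) space means M boxes, i.e. O(NM) numbers. *)

theory Defs
  imports "HOL-Analysis.Analysis"
begin

section \<open>The integral\<close>

text \<open>Points of \<open>N\<close>-dimensional space are lists of length \<open>N\<close>, so that \<open>N\<close> may vary inside a
  statement.\<close>

type_synonym point = "real list"

definition pos_points :: "nat \<Rightarrow> point set" where
  "pos_points N = {p. length p = N \<and> (\<forall>x\<in>set p. 0 < x)}"

definition std_simplex :: "nat \<Rightarrow> point set" where
  "std_simplex N = {w. length w = N \<and> (\<forall>x\<in>set w. 0 \<le> x) \<and> sum_list w = 1}"

definition gmax :: "point \<Rightarrow> point \<Rightarrow> real" where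
  "gmax p w = Max ((\<lambda>i. w ! i * p ! i) ` {..<length w})"

definition tau :: "point set \<Rightarrow> point \<Rightarrow> real" where
  "tau P w = Min ((\<lambda>p. gmax p w) ` P)"

text \<open>The simplex is integrated over in its first \<open>N - 1\<close> coordinates; the last one is one minus
  their sum. For \<open>N = 1\<close> the measure is the unit mass on the single point of the simplex.\<close>

definition complete_coords :: "nat \<Rightarrow> (nat \<Rightarrow> real) \<Rightarrow> point" where
  "complete_coords N v = map v [0..<N - 1] @ [1 - (\<Sum>i<N - 1. v i)]"

definition R2 :: "nat \<Rightarrow> point set \<Rightarrow> real" where
  "R2 N P = (LINT v : {v. complete_coords N v \<in> std_simplex N} | (\<Pi>\<^sub>M i\<in>{..<N - 1}. lborel).
     tau P (complete_coords N v))"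


section \<open>Boxes and decompositions\<close>

definition recip :: "point \<Rightarrow> point" where
  "recip p = map (\<lambda>x. 1 / x) p"

definition lower_union :: "point set \<Rightarrow> point set" where
  "lower_union Q = (\<Union>q\<in>Q. {x. length x = length q \<and> (\<forall>i<length q. 0 \<le> x ! i \<and> x ! i \<le> q ! i)})"

text \<open>A box is its list of pairs of a lower and an upper bound; upper bounds may be infinite.\<close>

type_synonym box = "(real \<times> ereal) list"

definition box_set :: "box \<Rightarrow> point set" where
  "box_set C = {x. length x = length C \<and>
     (\<forall>i<length C. fst (C ! i) \<le> x ! i \<and> ereal (x ! i) \<le> snd (C ! i))}"

definition box_interior :: "box \<Rightarrow> point set" where
  "box_interior C = {x. length x = length C \<and>
     (\<forall>i<length C. fst (C ! i) < x ! i \<and> ereal (x ! i) < snd (C ! i))}"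

definition box_decomposition :: "nat \<Rightarrow> point set \<Rightarrow> box list \<Rightarrow> bool" where
  "box_decomposition N U D \<longleftrightarrow>
     (\<forall>C\<in>set D. length C = N \<and> (\<forall>(l, u)\<in>set C. ereal l < u)) \<and>
     (\<Union>C\<in>set D. box_set C) = U \<and>
     (\<forall>i<length D. \<forall>j<length D. i \<noteq> j \<longrightarrow> box_interior (D ! i) \<inter> box_interior (D ! j) = {})"


section \<open>Computations with a time and a space count\<close>

text \<open>Storage is counted in numbers: a point takes \<open>N\<close> and a box \<open>2 * N\<close> units.\<close>

class storage =
  fixes units :: "'a \<Rightarrow> nat"

instantiation real :: storage
begin
definition units_real :: "real \<Rightarrow> nat" where "units_real x = 1"
instance ..
end

instantiation ereal :: storage
begin
definition units_ereal :: "ereal \<Rightarrow> nat" where "units_ereal x = 1"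
instance ..
end

instantiation prod :: (storage, storage) storage
begin
definition units_prod :: "'a \<times> 'b \<Rightarrow> nat" where "units_prod x = units (fst x) + units (snd x)"
instance ..
end

instantiation list :: (storage) storage
begin
definition units_list :: "'a list \<Rightarrow> nat" where "units_list xs = sum_list (map units xs)"
instance ..
end

text \<open>A computation has a result, a number of exact real operations, and a peak number of stored
  numbers. In a sequential composition the first result stays stored while the rest of the
  computation runs. Every arithmetic operation and every comparison of numbers (\<open>min\<close>, \<open>max\<close>)
  costs one time unit. Copying numbers and manipulating integer indices take no time.\<close>

datatype 'a comp = Comp (result: 'a) (time: nat) (peak: nat)

definition return :: "'a::storage \<Rightarrow> 'a comp" where
  "return x = Comp x 0 (units x)"

definition bind :: "'a::storage comp \<Rightarrow> ('a \<Rightarrow> 'b comp) \<Rightarrow> 'b comp" (infixl "\<rhd>" 54) where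
  "m \<rhd> f = (let m' = f (result m) in
     Comp (result m') (time m + time m') (max (peak m) (units (result m) + peak m')))"

definition radd :: "real \<Rightarrow> real \<Rightarrow> real comp" where "radd x y = Comp (x + y) 1 1"
definition rsub :: "real \<Rightarrow> real \<Rightarrow> real comp" where "rsub x y = Comp (x - y) 1 1"
definition rmul :: "real \<Rightarrow> real \<Rightarrow> real comp" where "rmul x y = Comp (x * y) 1 1"
definition rdiv :: "real \<Rightarrow> real \<Rightarrow> real comp" where "rdiv x y = Comp (x / y) 1 1"
definition rmin :: "real \<Rightarrow> real \<Rightarrow> real comp" where "rmin x y = Comp (min x y) 1 1"
definition rmax :: "real \<Rightarrow> real \<Rightarrow> real comp" where "rmax x y = Comp (max x y) 1 1"

primrec map_comp :: "('a \<Rightarrow> 'b::storage comp) \<Rightarrow> 'a list \<Rightarrow> 'b list comp" where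
  "map_comp f [] = return []"
| "map_comp f (x # xs) = f x \<rhd> (\<lambda>y. map_comp f xs \<rhd> (\<lambda>ys. return (y # ys)))"

primrec fold_comp :: "('a \<Rightarrow> 's::storage \<Rightarrow> 's comp) \<Rightarrow> 'a list \<Rightarrow> 's \<Rightarrow> 's comp" where
  "fold_comp f [] s = return s"
| "fold_comp f (x # xs) s = f x s \<rhd> (\<lambda>s'. fold_comp f xs s')"


section \<open>The perspective algorithm\<close>

primrec count_fact :: "nat \<Rightarrow> (real \<times> real) comp" where
  "count_fact 0 = return (0, 1)"
| "count_fact (Suc k) =
     count_fact k \<rhd> (\<lambda>(j, f). radd j 1 \<rhd> (\<lambda>j'. rmul f j' \<rhd> (\<lambda>f'. return (j', f'))))"

definition inv_fact :: "nat \<Rightarrow> real comp" where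
  "inv_fact N = count_fact N \<rhd> (\<lambda>(_, f). rdiv 1 f)"

text \<open>\<open>corner_sum 0 C\<close> is the signed sum of the reciprocals of \<open>x\<^sub>1 + \<dots> + x\<^sub>N\<close> over the \<open>2^N\<close>
  corners of \<open>C\<close>: the first argument is the sum of the coordinates chosen so far, and each choice of
  an upper bound contributes a minus sign. Corners with an infinite coordinate contribute zero.\<close>

fun corner_sum :: "real \<Rightarrow> box \<Rightarrow> real comp" where
  "corner_sum s [] = rdiv 1 s"
| "corner_sum s ((l, u) # C) =
     radd s l \<rhd> (\<lambda>sl. corner_sum sl C) \<rhd> (\<lambda>x.
       case u of
         ereal r \<Rightarrow> radd s r \<rhd> (\<lambda>su. corner_sum su C) \<rhd> (\<lambda>y. rsub x y)
       | _ \<Rightarrow> return x)"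

text \<open>The weighted box integral, with \<open>c\<close> standing for the precomputed \<open>1 / N!\<close>.\<close>

definition box_integral :: "real \<Rightarrow> box \<Rightarrow> real comp" where
  "box_integral c C = corner_sum 0 C \<rhd> (\<lambda>x. rmul c x)"

text \<open>With \<open>A\<close> the product of the intervals from \<open>0\<close> to \<open>u\<^sub>i\<close>, the \<open>k\<close>-th semi-infinite box outside
  \<open>A\<close> (indices start at \<open>0\<close>).\<close>

definition outer_box :: "point \<Rightarrow> nat \<Rightarrow> box" where
  "outer_box u k = map (\<lambda>i. if i < k then (0, ereal (u ! i))
     else if i = k then (u ! k, \<infinity>) else (0, \<infinity>)) [0..<length u]"

text \<open>Slab decomposition of the part of \<open>Q\<close> outside \<open>A\<close>. The cuts are the \<open>u\<^sub>i\<close>, moved into the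
  sides of \<open>Q\<close>; the \<open>k\<close>-th slab lies below the cut in the coordinates before \<open>k\<close> and above it in
  coordinate \<open>k\<close>. Slabs that would be empty come out as boxes with a side of length zero, whose
  weighted integral is zero.\<close>

definition cuts :: "point \<Rightarrow> box \<Rightarrow> point comp" where
  "cuts u Q = map_comp (\<lambda>((l, h), v).
     case h of ereal r \<Rightarrow> rmin r v \<rhd> (\<lambda>t. rmax l t) | _ \<Rightarrow> rmax l v) (zip Q u)"

definition slab :: "point \<Rightarrow> box \<Rightarrow> nat \<Rightarrow> box" where
  "slab m Q k = map (\<lambda>i. if i < k then (fst (Q ! i), ereal (m ! i))
     else if i = k then (m ! k, snd (Q ! k)) else Q ! i) [0..<length Q]"

text \<open>Two ways to evaluate the contribution of the \<open>k\<close>-th slab \<open>C\<close>. The first is the full corner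
  formula. The second leaves out the corners whose terms cancel between different slabs of the same
  \<open>Q\<close>, with the same sum over all slabs. What remains of \<open>C\<close> are

  \<^item> the corners at the lower bound in all coordinates from \<open>k\<close> on, and

  \<^item> the corners at the lower bound in all coordinates before \<open>k\<close> and at the upper bound in
    coordinate \<open>k\<close>; the latter accounts for the minus sign in \<open>rsub\<close>.

  An upper bound is put to \<open>\<infinity>\<close> to leave out the corners that use it. Over the \<open>N\<close> slabs of one \<open>Q\<close>
  the first way evaluates \<open>N * 2^N\<close> corners and the second \<open>2 * (2^N - 1)\<close>.\<close>

definition slab_integral_full :: "real \<Rightarrow> nat \<Rightarrow> box \<Rightarrow> real comp" where
  "slab_integral_full c k C = box_integral c C"

definition only_lower :: "box \<Rightarrow> box" where
  "only_lower C = map (\<lambda>(l, u). (l, \<infinity>)) C"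

definition slab_integral_cancelled :: "real \<Rightarrow> nat \<Rightarrow> box \<Rightarrow> real comp" where
  "slab_integral_cancelled c k C =
     return (take k C @ only_lower (drop k C)) \<rhd> (\<lambda>B. corner_sum 0 B) \<rhd> (\<lambda>x.
     return (only_lower (take k C) @ (real_of_ereal (snd (C ! k)), \<infinity>) # drop (Suc k) C)
       \<rhd> (\<lambda>B. corner_sum 0 B) \<rhd> (\<lambda>y.
     rsub x y \<rhd> (\<lambda>z. rmul c z)))"

text \<open>The decomposition routine is a black box that maps \<open>P\<close> to a list of boxes and the time taken.
  Its output is stored; its private working space is not counted.\<close>

type_synonym routine = "point set \<Rightarrow> box list \<times> nat"

definition call_routine :: "routine \<Rightarrow> point set \<Rightarrow> box list comp" where
  "call_routine dec P = Comp (fst (dec P)) (snd (dec P)) (units (fst (dec P)))"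

definition perspective ::
  "(real \<Rightarrow> nat \<Rightarrow> box \<Rightarrow> real comp) \<Rightarrow> routine \<Rightarrow> nat \<Rightarrow> point set \<Rightarrow> point \<Rightarrow> real comp" where
  "perspective slab_integral dec N P a =
     map_comp (\<lambda>x. rdiv 1 x) a \<rhd> (\<lambda>u.
     inv_fact N \<rhd> (\<lambda>c.
     fold_comp (\<lambda>k R. return (outer_box u k) \<rhd> (\<lambda>C. box_integral c C) \<rhd> (\<lambda>x. radd R x))
       [0..<N] 0 \<rhd> (\<lambda>Ra.
     call_routine dec P \<rhd> (\<lambda>D.
     fold_comp (\<lambda>Q I. cuts u Q \<rhd> (\<lambda>m.
         fold_comp (\<lambda>k J. return (slab m Q k) \<rhd> (\<lambda>C. slab_integral c k C) \<rhd> (\<lambda>x. radd J x))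
           [0..<N] I))
       D 0 \<rhd> (\<lambda>I.
     rsub Ra I)))))"

definition perspective_input :: "nat \<Rightarrow> point set \<Rightarrow> point \<Rightarrow> routine \<Rightarrow> bool" where
  "perspective_input N P a dec \<longleftrightarrow>
     N \<ge> 1 \<and> finite P \<and> P \<noteq> {} \<and> P \<subseteq> pos_points N \<and> a \<in> pos_points N \<and>
     (\<forall>p\<in>P. \<forall>i<N. p ! i \<le> a ! i) \<and>
     box_decomposition N (lower_union (recip ` P)) (fst (dec P))"

end

theory Submission
  imports Defs
begin

text \<open>Writing \<open>x = t w\<close> with \<open>t > 0\<close> and \<open>w\<close> in the simplex turns \<open>dx\<close> into \<open>t\<^sup>N\<^sup>-\<^sup>1 dt dw\<close>. The ray
  through \<open>w\<close> leaves \<open>U(b(P))\<close> at \<open>t = 1 / \<tau>\<^sub>P(w)\<close>, and the integral of \<open>t\<^sup>N\<^sup>-\<^sup>1 t\<^sup>-\<^sup>(\<^sup>N\<^sup>+\<^sup>1\<^sup>)\<close>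
  from there to infinity is \<open>\<tau>\<^sub>P(w)\<close>. So \<open>R\<^sub>2(P)\<close> is the integral of the weight
  \<open>(x\<^sub>1 + \<dots> + x\<^sub>N)\<^sup>-\<^sup>(\<^sup>N\<^sup>+\<^sup>1\<^sup>)\<close> over the part of the orthant outside \<open>U(b(P))\<close>. As \<open>A \<subseteq> U(b(P))\<close>, this
  is the integral outside \<open>A\<close> minus the integrals over the sets \<open>Q - A\<close>, and both are sums over slabs
  on which the corner formula applies. Every slab stays away from the origin,
  because its \<open>k\<close>-th side starts at or above a positive cut. The time is dominated by the number of
  evaluated corners, which is geometric in \<open>k\<close> once the cancelling corners are left out.\<close>

section \<open>Cost of the algorithm\<close>

lemma result_bind [simp]: "result (m \<rhd> f) = result (f (result m))"
  and time_bind [simp]: "time (m \<rhd> f) = time m + time (f (result m))"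
  and peak_bind [simp]: "peak (m \<rhd> f) = max (peak m) (units (result m) + peak (f (result m)))"
  by (simp_all add: bind_def Let_def)

lemma return_simps [simp]:
  "result (return x) = x" "time (return x) = 0" "peak (return x) = units x"
  by (simp_all add: return_def)

lemmas arith_comp_defs = radd_def rsub_def rmul_def rdiv_def rmin_def rmax_def

lemma units_simps [simp]:
  "units (x::real) = 1" "units (y::ereal) = 1" "units (p::'a::storage \<times> 'b::storage) = units (fst p) + units (snd p)"
  "units ([]::'a list) = 0" "units (z # zs :: 'a list) = units z + units zs"
  by (simp_all add: units_real_def units_ereal_def units_prod_def units_list_def)

lemma units_point: "units (p::point) = length p"
  by (induction p) auto

lemma units_box: "units (C::box) = 2 * length C"
  by (induction C) auto

lemma result_map_comp [simp]: "result (map_comp f xs) = map (\<lambda>x. result (f x)) xs"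
  by (induction xs) auto

lemma time_map_comp [simp]: "time (map_comp f xs) = (\<Sum>x\<leftarrow>xs. time (f x))"
  by (induction xs) auto

text \<open>The factor 2 comes from prepending an element: the tail's result list and the extended
  list are then both stored.\<close>

lemma peak_map_comp_le:
  fixes f :: "'a \<Rightarrow> real comp"
  assumes "\<And>x. x \<in> set xs \<Longrightarrow> peak (f x) \<le> B"
  shows "peak (map_comp f xs) \<le> 2 * length xs + B"
  using assms
proof (induction xs)
  case (Cons x xs)
  have "units (map (\<lambda>x. result (f x)) xs) = length xs"
    by (simp add: units_point)
  moreover have "peak (f x) \<le> B" "peak (map_comp f xs) \<le> 2 * length xs + B"
    using Cons by auto
  ultimately show ?case by auto
qed auto

lemma time_fold_comp_le:
  assumes "\<And>x s. x \<in> set xs \<Longrightarrow> time (f x s) \<le> B x"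
  shows "time (fold_comp f xs s) \<le> (\<Sum>x\<leftarrow>xs. B x)"
  using assms by (induction xs arbitrary: s) (auto intro!: add_mono)

text \<open>A bind keeps its first result while the rest runs, so the accumulators add up to one
  number per list element. \<open>B\<close> is charged only once, because a finished step leaves
  nothing but its accumulator.\<close>

lemma peak_fold_comp_le:
  fixes f :: "'a \<Rightarrow> real \<Rightarrow> real comp"
  assumes "\<And>x s. x \<in> set xs \<Longrightarrow> peak (f x s) \<le> B"
  shows "peak (fold_comp f xs s) \<le> length xs + 1 + B"
  using assms
proof (induction xs arbitrary: s)
  case (Cons x xs)
  have "peak (f x s) \<le> B" "peak (fold_comp f xs (result (f x s))) \<le> length xs + 1 + B"
    using Cons by auto
  then show ?case by simp
qed auto

lemma result_fold_comp_add:
  fixes s :: real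
  assumes "\<And>x s. x \<in> set xs \<Longrightarrow> result (f x s) = s + g x"
  shows "result (fold_comp f xs s) = s + (\<Sum>x\<leftarrow>xs. g x)"
  using assms by (induction xs arbitrary: s) auto

section \<open>Costs of the factorial, the corner sums and the slabs\<close>

lemma count_fact:
  "result (count_fact k) = (real k, fact k)" "time (count_fact k) = 2 * k"
  "peak (count_fact k) \<le> 3 * k + 6"
proof -
  show *: "result (count_fact k) = (real k, fact k)" for k
    by (induction k) (simp_all add: arith_comp_defs algebra_simps)
  show "time (count_fact k) = 2 * k"
    by (induction k) (simp_all add: arith_comp_defs *)
  show "peak (count_fact k) \<le> 3 * k + 6"
    by (induction k) (simp_all add: arith_comp_defs *)
qed

lemma inv_fact:
  "result (inv_fact N) = 1 / fact N" "time (inv_fact N) = 2 * N + 1"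
  "peak (inv_fact N) \<le> 3 * N + 6"
  using count_fact(3)[of N] by (simp_all add: inv_fact_def count_fact arith_comp_defs)

text \<open>Coordinates with an infinite upper bound do not branch, so the tail costs one addition
  each and a final division. A finite coordinate turns a cost \<open>T\<close> into
  \<open>2 * T + 3\<close> (two additions, one subtraction), that is, it doubles
  \<open>T + 3\<close>.\<close>

lemma time_corner_sum_append_only_lower:
  "time (corner_sum s (B @ only_lower C)) \<le> 2 ^ length B * (length C + 4) - 3"
proof -
  have *: "time (corner_sum s (only_lower C)) = length C + 1" for s
    by (induction C arbitrary: s) (auto simp: only_lower_def arith_comp_defs)
  show ?thesis
  proof (induction B arbitrary: s)
    case Nil
    then show ?case by (simp add: *)
  next
    case (Cons b B)
    obtain l u where b: "b = (l, u)" by force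
    \<comment> \<open>This keeps the subtraction of 3 on natural numbers from truncating.\<close>
    have "2 ^ length B * (length C + 4) \<ge> 1 * (4::nat)"
      by (intro mult_mono) auto
    then show ?case
      using Cons.IH[of "s + l"] Cons.IH[of "s + real_of_ereal u"]
      by (cases u) (auto simp: arith_comp_defs b)
  qed
qed

lemma time_corner_sum: "time (corner_sum s C) \<le> 4 * 2 ^ length C - 3"
  using time_corner_sum_append_only_lower[of s C "[]"] by (simp add: only_lower_def)

text \<open>In front of the branching coordinates, the non-branching ones are added up only once.
  Their number enters additively here, whereas behind the branching coordinates it is multiplied by
  the number of branches.\<close>

lemma time_corner_sum_only_lower_append:
  "time (corner_sum s (only_lower B @ C)) \<le> length B + (4 * 2 ^ length C - 3)"
proof (induction B arbitrary: s)
  case Nil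
  then show ?case by (simp add: only_lower_def time_corner_sum)
next
  case (Cons b B)
  obtain l u where b: "b = (l, u)" by force
  show ?case
    using Cons.IH[of "s + l"] by (auto simp: arith_comp_defs b only_lower_def)
qed

text \<open>Space follows the depth of the recursion, not the number of corners: while the second
  half runs, each level holds one partial sum and the value of the first half.\<close>

lemma peak_corner_sum: "peak (corner_sum s C) \<le> 2 * length C + 1"
proof (induction C arbitrary: s)
  case Nil
  then show ?case by (simp add: arith_comp_defs)
next
  case (Cons b C)
  obtain l u where b: "b = (l, u)" by force
  show ?case
    using Cons.IH[of "s + l"] Cons.IH[of "s + real_of_ereal u"]
    by (cases u) (auto simp: arith_comp_defs b)
qed

lemma box_integral:
  "result (box_integral c C) = c * result (corner_sum 0 C)"
  "time (box_integral c C) = time (corner_sum 0 C) + 1"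
  "peak (box_integral c C) \<le> 2 * length C + 2"
  using peak_corner_sum[of 0 C] by (simp_all add: box_integral_def arith_comp_defs)

lemma length_slab [simp]: "length (slab m Q k) = length Q"
  and length_outer_box [simp]: "length (outer_box u k) = length u"
  and length_only_lower [simp]: "length (only_lower C) = length C"
  by (simp_all add: slab_def outer_box_def only_lower_def)

text \<open>The first corner sum branches only in the \<open>k\<close> coordinates before
  \<open>k\<close>, the second only in those after \<open>k\<close>. The final 2 counts the
  subtraction and the multiplication by \<open>c\<close>.\<close>

lemma slab_cancelled_cost:
  assumes "k < length C"
  shows "time (slab_integral_cancelled c k C)
      \<le> 2 ^ k * (length C - k + 4) + (k + 2 ^ (Suc (length C - k))) + 2"
    and "peak (slab_integral_cancelled c k C) \<le> 10 * length C + 10"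
proof -
  obtain n where n: "length C = k + Suc n"
    using assms less_imp_Suc_add by auto
  let ?B = "take k C @ only_lower (drop k C)"
  let ?E = "only_lower (take k C) @ (real_of_ereal (snd (C ! k)), \<infinity>) # drop (Suc k) C"
  have B: "time (corner_sum 0 ?B) \<le> 2 ^ k * (length C - k + 4)"
    using time_corner_sum_append_only_lower[of 0 "take k C" "drop k C"] assms by (simp add: min_def)
  \<comment> \<open>Coordinate \<open>k\<close> starts at the upper bound of \<open>C ! k\<close>
    and is unbounded, so it joins the non-branching prefix, which thus has length
    \<open>Suc k\<close>.\<close>
  have E: "?E = only_lower (take k C @ [(real_of_ereal (snd (C ! k)), \<infinity>)]) @ drop (Suc k) C"
    by (simp add: only_lower_def)
  have "time (corner_sum 0 ?E) \<le> Suc k + (4 * 2 ^ n - 3)"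
    unfolding E
    using time_corner_sum_only_lower_append[of 0 "take k C @ [(real_of_ereal (snd (C ! k)), \<infinity>)]" "drop (Suc k) C"]
      assms by (simp add: n)
  also have "\<dots> \<le> k + 4 * 2 ^ n"
    using one_le_power[of "2::nat" n] by linarith
  also have "\<dots> = k + 2 ^ (Suc (length C - k))"
    by (simp add: n)
  finally show "time (slab_integral_cancelled c k C)
      \<le> 2 ^ k * (length C - k + 4) + (k + 2 ^ (Suc (length C - k))) + 2"
    using B by (simp add: slab_integral_cancelled_def arith_comp_defs)
  show "peak (slab_integral_cancelled c k C) \<le> 10 * length C + 10"
    using peak_corner_sum[of 0 ?B] peak_corner_sum[of 0 ?E] assms
    by (simp add: slab_integral_cancelled_def arith_comp_defs units_box del: units_simps(5))
qed

text \<open>The factor \<open>N - k + 4\<close> is small where \<open>2 ^ k\<close> is large, so no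
  factor \<open>N\<close> survives. From \<open>N\<close> to \<open>Suc N\<close> the old summands
  grow by \<open>2 ^ N - 1\<close> in total and the new one is \<open>5 * 2 ^ N\<close>.\<close>

lemma sum_two_power_le: "(\<Sum>k<N. 2 ^ k * (N - k + 4)) \<le> 6 * 2 ^ N - (6::nat)"
proof (induction N)
  case (Suc N)
  have "(\<Sum>k<N. 2 ^ k * (Suc N - k + 4)) = (\<Sum>k<N. 2 ^ k * (N - k + 4)) + (\<Sum>k<N. 2 ^ k)"
    unfolding sum.distrib[symmetric]
    by (intro sum.cong) (auto simp: Suc_diff_le algebra_simps)
  moreover have "(\<Sum>k<N. 2 ^ k) = 2 ^ N - (1::nat)"
    by (induction N) auto
  moreover have "2 ^ N \<ge> (1::nat)" by simp
  ultimately show ?case using Suc by simp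
qed auto

text \<open>The geometric part is \<open>4 * 2 ^ N - 4\<close>, and the sum of the \<open>k\<close>
  fits into another \<open>2 ^ N\<close>. In the induction the increment is
  \<open>N + 4 * 2 ^ N\<close>, below \<open>5 * 2 ^ N\<close> by \<open>N < 2 ^ N\<close>.\<close>

lemma sum_two_power_le': "(\<Sum>k<N. k + 2 ^ (Suc (N - k))) \<le> 5 * 2 ^ N"
proof -
  have "(\<Sum>k<N. k) + (\<Sum>k<N. 2 ^ (Suc (N - k))) + 4 \<le> 5 * (2::nat) ^ N"
  proof (induction N)
    case (Suc N)
    have "(\<Sum>k<Suc N. 2 ^ (Suc (Suc N - k))) = 2 ^ (N + 2) + (\<Sum>k<N. 2 ^ (Suc (N - k)) :: nat)"
      by (subst sum.lessThan_Suc_shift) simp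
    moreover have "(2::nat) ^ (N + 2) = 4 * 2 ^ N" "(2::nat) ^ Suc N = 2 * 2 ^ N"
      "(\<Sum>k<Suc N. k) = (\<Sum>k<N. k) + N" by simp_all
    ultimately show ?case using Suc less_exp[of N] by linarith
  qed auto
  then show ?thesis by (simp add: sum.distrib)
qed

text \<open>Here the cancellation pays off: all slabs of one box together cost a multiple of
  \<open>2 ^ N\<close>. Per slab, 3 operations are left over: a subtraction, a multiplication and
  the addition to the accumulator.\<close>

lemma sum_slab_cancelled_time:
  assumes "length Q = N"
  shows "(\<Sum>k\<leftarrow>[0..<N]. time (slab_integral_cancelled c k (slab m Q k)) + 1) \<le> 11 * 2 ^ N + 3 * N"
proof -
  have "(\<Sum>k\<leftarrow>[0..<N]. time (slab_integral_cancelled c k (slab m Q k)) + 1)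
      = (\<Sum>k<N. time (slab_integral_cancelled c k (slab m Q k)) + 1)"
    by (simp add: sum_list_distinct_conv_sum_set atLeast0LessThan)
  also have "\<dots> \<le> (\<Sum>k<N. 2 ^ k * (N - k + 4) + (k + 2 ^ (Suc (N - k))) + 3)"
    using slab_cancelled_cost(1)[of _ "slab m Q _" c] assms
    by (intro sum_mono) (auto simp: eval_nat_numeral)
  also have "\<dots> = (\<Sum>k<N. 2 ^ k * (N - k + 4)) + (\<Sum>k<N. k + 2 ^ (Suc (N - k))) + 3 * N"
    by (simp add: sum.distrib)
  also have "\<dots> \<le> 11 * 2 ^ N + 3 * N"
    using sum_two_power_le[of N] sum_two_power_le'[of N] by linarith
  finally show ?thesis .
qed

lemma slab_full_cost:
  "time (slab_integral_full c k C) \<le> 4 * 2 ^ length C"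
  "peak (slab_integral_full c k C) \<le> 10 * length C + 10"
proof -
  show "time (slab_integral_full c k C) \<le> 4 * 2 ^ length C"
    unfolding slab_integral_full_def box_integral
    using time_corner_sum[of 0 C] one_le_power[of "2::nat" "length C"] by linarith
  show "peak (slab_integral_full c k C) \<le> 10 * length C + 10"
    using box_integral(3)[of c C] by (simp add: slab_integral_full_def)
qed

text \<open>This exhibits the box as a finite prefix with an unbounded tail, so only the first
  \<open>k\<close> coordinates branch and all \<open>N\<close> outer boxes together cost a multiple
  of \<open>2 ^ N\<close> up to a linear term.\<close>

lemma outer_box_eq:
  assumes "k < length u"
  shows "outer_box u k = (map (\<lambda>i. (0, ereal (u ! i))) [0..<k]) @
    only_lower ((u ! k, \<infinity>) # replicate (length u - Suc k) (0, \<infinity>))"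
  using assms by (intro nth_equalityI) (auto simp: outer_box_def only_lower_def nth_append nth_Cons')

lemma outer_box_time:
  assumes "k < length u"
  shows "time (corner_sum 0 (outer_box u k)) \<le> 2 ^ k * (length u - k + 4)"
proof -
  have "Suc (length u - Suc k) = length u - k" using assms by simp
  then show ?thesis
    using time_corner_sum_append_only_lower[of 0 "map (\<lambda>i. (0, ereal (u ! i))) [0..<k]"
       "(u ! k, \<infinity>) # replicate (length u - Suc k) (0, \<infinity>)"]
    unfolding outer_box_eq[OF assms] by simp
qed

lemma time_cuts: "length u = length Q \<Longrightarrow> time (cuts u Q) \<le> 2 * length Q"
proof -
  assume *: "length u = length Q"
  have "time (cuts u Q) \<le> (\<Sum>x\<leftarrow>zip Q u. 2)"
    unfolding cuts_def time_map_comp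
    by (rule sum_list_mono) (auto simp: arith_comp_defs split: ereal.splits)
  then show ?thesis using * by (simp add: sum_list_triv)
qed

lemma peak_cuts: "length u = length Q \<Longrightarrow> peak (cuts u Q) \<le> 2 * length Q + 2"
proof -
  assume *: "length u = length Q"
  have "peak (cuts u Q) \<le> 2 * length (zip Q u) + 2"
    unfolding cuts_def
    by (rule peak_map_comp_le) (auto simp: arith_comp_defs split: ereal.splits)
  then show ?thesis using * by simp
qed

lemma length_result_cuts [simp]: "length u = length Q \<Longrightarrow> length (result (cuts u Q)) = length Q"
  by (simp add: cuts_def)

section \<open>Time and space of the whole algorithm\<close>

context
  fixes S :: "real \<Rightarrow> nat \<Rightarrow> box \<Rightarrow> real comp" and dec :: routine and N :: nat
    and P :: "point set" and a :: point
  assumes len_a: "length a = N"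
    and len_D: "\<And>Q. Q \<in> set (fst (dec P)) \<Longrightarrow> length Q = N"
begin

text \<open>\<open>W\<close> bounds all slabs of one box together, since the geometric saving shows
  only in the sum over \<open>k\<close>. The part independent of the boxes consists of the outer
  boxes (\<open>6 * 2 ^ N + 2 * N\<close>), the reciprocals (\<open>N\<close>), the factorial
  (\<open>2 * N + 1\<close>) and the last subtraction.\<close>

lemma time_perspective:
  assumes "\<And>Q m c. length Q = N \<Longrightarrow> (\<Sum>k\<leftarrow>[0..<N]. time (S c k (slab m Q k)) + 1) \<le> W"
  shows "time (perspective S dec N P a)
    \<le> snd (dec P) + length (fst (dec P)) * (2 * N + W) + (6 * 2 ^ N + 5 * N + 2)"
proof -
  define u where "u = result (map_comp (\<lambda>x. rdiv 1 x) a)"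
  have u: "length u = N" by (simp add: u_def len_a)
  have outer: "time (fold_comp (\<lambda>k R. return (outer_box u k) \<rhd> (\<lambda>C. box_integral c C) \<rhd> (\<lambda>x. radd R x))
       [0..<N] 0) \<le> 6 * 2 ^ N + 2 * N" for c
  proof -
    have "time (fold_comp (\<lambda>k R. return (outer_box u k) \<rhd> (\<lambda>C. box_integral c C) \<rhd> (\<lambda>x. radd R x)) [0..<N] 0)
        \<le> (\<Sum>k\<leftarrow>[0..<N]. 2 ^ k * (N - k + 4) + 2)"
    proof (rule time_fold_comp_le)
      fix k s assume "k \<in> set [0..<N]"
      then show "time (return (outer_box u k) \<rhd> (\<lambda>C. box_integral c C) \<rhd> (\<lambda>x. radd s x))
          \<le> 2 ^ k * (N - k + 4) + 2"
        using outer_box_time[of k u] u by (simp add: box_integral arith_comp_defs)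
    qed
    also have "\<dots> = (\<Sum>k<N. 2 ^ k * (N - k + 4)) + 2 * N"
      unfolding sum_list_distinct_conv_sum_set[OF distinct_upt] set_upt atLeast0LessThan sum.distrib by simp
    also have "\<dots> \<le> 6 * 2 ^ N + 2 * N" using sum_two_power_le[of N] by linarith
    finally show ?thesis .
  qed
  have main: "time (fold_comp (\<lambda>Q I. cuts u Q \<rhd> (\<lambda>m.
         fold_comp (\<lambda>k J. return (slab m Q k) \<rhd> (\<lambda>C. S c k C) \<rhd> (\<lambda>x. radd J x))
           [0..<N] I)) (fst (dec P)) 0) \<le> length (fst (dec P)) * (2 * N + W)" for c
  proof -
    have "time (fold_comp (\<lambda>Q I. cuts u Q \<rhd> (\<lambda>m.
         fold_comp (\<lambda>k J. return (slab m Q k) \<rhd> (\<lambda>C. S c k C) \<rhd> (\<lambda>x. radd J x))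
           [0..<N] I)) (fst (dec P)) 0) \<le> (\<Sum>Q\<leftarrow>fst (dec P). 2 * N + W)"
    proof (rule time_fold_comp_le)
      fix Q I assume "Q \<in> set (fst (dec P))"
      then have Q: "length Q = N" by (rule len_D)
      have "time (fold_comp (\<lambda>k J. return (slab m Q k) \<rhd> (\<lambda>C. S c k C) \<rhd> (\<lambda>x. radd J x)) [0..<N] I)
         \<le> (\<Sum>k\<leftarrow>[0..<N]. time (S c k (slab m Q k)) + 1)" for m
        by (rule time_fold_comp_le) (simp add: arith_comp_defs)
      also have "\<dots> m \<le> W" for m using assms[OF Q] .
      finally show "time (cuts u Q \<rhd> (\<lambda>m.
         fold_comp (\<lambda>k J. return (slab m Q k) \<rhd> (\<lambda>C. S c k C) \<rhd> (\<lambda>x. radd J x))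
           [0..<N] I)) \<le> 2 * N + W"
        using time_cuts[of u Q] u Q by (simp add: add_mono)
    qed
    then show ?thesis by (simp add: sum_list_triv)
  qed
  have "time (map_comp (\<lambda>x. rdiv 1 x) a) = N"
    by (simp add: rdiv_def sum_list_triv len_a)
  then show ?thesis
    unfolding perspective_def time_bind u_def[symmetric] inv_fact call_routine_def comp.sel
    using outer[of "result (inv_fact N)"] main[of "result (inv_fact N)"]
    by (simp add: rsub_def inv_fact del: time_map_comp)
qed

text \<open>The stored decomposition takes \<open>2 * N\<close> numbers per box and the fold over it
  one accumulator per box. Everything else is linear in \<open>N\<close> and is absorbed because
  there is at least one box.\<close>

lemma peak_perspective:
  assumes "\<And>Q m c k. length Q = N \<Longrightarrow> k < N \<Longrightarrow> peak (S c k (slab m Q k)) \<le> 10 * N + 10"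
    and "N \<ge> 1" "length (fst (dec P)) \<ge> 1"
  shows "peak (perspective S dec N P a) \<le> 100 * (N * length (fst (dec P)))"
proof -
  define D where "D = fst (dec P)"
  define u where "u = result (map_comp (\<lambda>x. rdiv 1 x) a)"
  have u: "length u = N" by (simp add: u_def len_a)
  have outer: "peak (fold_comp (\<lambda>k R. return (outer_box u k) \<rhd> (\<lambda>C. box_integral c C) \<rhd> (\<lambda>x. radd R x))
       [0..<N] 0) \<le> length [0..<N] + 1 + (4 * N + 4)" for c
  proof (rule peak_fold_comp_le)
    fix k s assume "k \<in> set [0..<N]"
    then show "peak (return (outer_box u k) \<rhd> (\<lambda>C. box_integral c C) \<rhd> (\<lambda>x. radd s x))
        \<le> 4 * N + 4"
      using box_integral(3)[of c "outer_box u k"] u by (simp add: arith_comp_defs units_box)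
  qed
  have main: "peak (fold_comp (\<lambda>Q I. cuts u Q \<rhd> (\<lambda>m.
         fold_comp (\<lambda>k J. return (slab m Q k) \<rhd> (\<lambda>C. S c k C) \<rhd> (\<lambda>x. radd J x))
           [0..<N] I)) D 0) \<le> length D + 1 + (14 * N + 14)" for c
  proof (rule peak_fold_comp_le)
    fix Q I assume "Q \<in> set D"
    then have Q: "length Q = N" using len_D by (simp add: D_def)
    have "peak (fold_comp (\<lambda>k J. return (slab m Q k) \<rhd> (\<lambda>C. S c k C) \<rhd> (\<lambda>x. radd J x)) [0..<N] I)
       \<le> length [0..<N] + 1 + (12 * N + 12)" for m
    proof (rule peak_fold_comp_le)
      fix k s assume "k \<in> set [0..<N]"
      then show "peak (return (slab m Q k) \<rhd> (\<lambda>C. S c k C) \<rhd> (\<lambda>x. radd s x)) \<le> 12 * N + 12"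
        using assms(1)[OF Q, of k c m] Q by (simp add: arith_comp_defs units_box)
    qed
    note this[of "result (cuts u Q)"]
    then show "peak (cuts u Q \<rhd> (\<lambda>m.
       fold_comp (\<lambda>k J. return (slab m Q k) \<rhd> (\<lambda>C. S c k C) \<rhd> (\<lambda>x. radd J x))
         [0..<N] I)) \<le> 14 * N + 14"
      using peak_cuts[of u Q] u Q by (simp add: units_point)
  qed
  have mp: "peak (map_comp (\<lambda>x. rdiv 1 x) a) \<le> 2 * N + 1"
    using peak_map_comp_le[of a "\<lambda>x. rdiv 1 x" 1] by (simp add: arith_comp_defs len_a)
  have "units D = 2 * N * length D"
  proof -
    have "units D = sum_list (map units D)" by (simp add: units_list_def)
    also have "map units D = map (\<lambda>_. 2 * N) D"
      using len_D by (intro map_cong) (auto simp: units_box D_def)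
    finally show ?thesis by (simp add: sum_list_triv)
  qed
  then have "peak (perspective S dec N P a) \<le> 2 * N * length D + length D + 50 * N + 30"
    unfolding perspective_def peak_bind u_def[symmetric] call_routine_def comp.sel D_def[symmetric]
    using outer[of "result (inv_fact N)"] main[of "result (inv_fact N)"] mp inv_fact(3)[of N]
    by (simp add: rsub_def units_point u)
  also have "\<dots> \<le> 100 * (N * length D)"
  proof -
    have "1 * length D \<le> N * length D" "N * 1 \<le> N * length D" "1 * 1 \<le> N * length D"
      using assms by (intro mult_mono; simp add: D_def)+
    then show ?thesis by linarith
  qed
  finally show ?thesis unfolding D_def .
qed

end

section \<open>The corner formula\<close>

abbreviation lebI :: "nat set \<Rightarrow> (nat \<Rightarrow> real) measure" where
  "lebI I \<equiv> \<Pi>\<^sub>M i\<in>I. lborel"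

interpretation leb: product_sigma_finite "\<lambda>_::nat. lborel :: real measure"
  by standard

text \<open>\<open>t\<close> will be the coordinate that is integrated out and \<open>y\<close> the
  offset plus all others. An exponent written \<open>n + 2\<close> is at least 2, so the
  antiderivative vanishes at infinity.\<close>

lemma DERIV_inverse_power:
  fixes x y :: real
  assumes "0 < y + x"
  shows "((\<lambda>t. - 1 / (real (n + 1) * (y + t) ^ (n + 1))) has_real_derivative 1 / (y + x) ^ (n + 2)) (at x within S)"
proof -
  have "(y + x) ^ n + real n * (y + x) ^ (n - Suc 0) * (y + x) = (1 + real n) * (y + x) ^ n"
    by (cases n) (auto simp: algebra_simps)
  with assms show ?thesis
    by (auto intro!: derivative_eq_intros simp: divide_simps)
qed

lemma nn_integral_inverse_power_atLeast:
  fixes y l :: real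
  assumes "0 < y + l"
  shows "(\<integral>\<^sup>+t. ennreal (1 / (y + t) ^ (n + 2)) * indicator {l..} t \<partial>lborel)
    = ennreal (1 / (y + l) ^ (n + 1) / real (n + 1))"
proof -
  have "((\<lambda>t. - 1 / (real (n + 1) * (y + t) ^ (n + 1))) \<longlongrightarrow> 0) at_top"
    by (intro tendsto_divide_0[OF tendsto_const] filterlim_at_top_imp_at_infinity
        filterlim_tendsto_pos_mult_at_top[OF tendsto_const] filterlim_pow_at_top
        filterlim_tendsto_add_at_top[OF tendsto_const] filterlim_ident) auto
  then have "(\<integral>\<^sup>+t. ennreal (1 / (y + t) ^ (n + 2)) * indicator {l..} t \<partial>lborel)
      = 0 - (- 1 / (real (n + 1) * (y + l) ^ (n + 1)))"
  proof (rule nn_integral_FTC_atLeast[rotated 3])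
    fix x assume "l \<le> x"
    then have "y + x > 0" using assms by simp
    from DERIV_inverse_power[OF this]
    show "((\<lambda>t. - 1 / (real (n + 1) * (y + t) ^ (n + 1))) has_real_derivative 1 / (y + x) ^ (n + 2)) (at x)" .
    show "0 \<le> 1 / (y + x) ^ (n + 2)" using \<open>y + x > 0\<close> by simp
  qed simp
  then show ?thesis by (simp add: field_simps)
qed

lemma nn_integral_inverse_power_Icc:
  fixes y l r :: real
  assumes "0 < y + l" "l \<le> r"
  shows "(\<integral>\<^sup>+t. ennreal (1 / (y + t) ^ (n + 2)) * indicator {l..r} t \<partial>lborel)
    = ennreal ((1 / (y + l) ^ (n + 1) - 1 / (y + r) ^ (n + 1)) / real (n + 1))"
proof -
  have "(\<integral>\<^sup>+t. ennreal (1 / (y + t) ^ (n + 2)) * indicator {l..r} t \<partial>lborel)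
      = - 1 / (real (n + 1) * (y + r) ^ (n + 1)) - (- 1 / (real (n + 1) * (y + l) ^ (n + 1)))"
  proof (rule nn_integral_FTC_Icc)
    fix x assume "x \<in> {l..r}"
    then have "y + x > 0" using assms by simp
    from DERIV_inverse_power[OF this]
    show "((\<lambda>t. - 1 / (real (n + 1) * (y + t) ^ (n + 1))) has_real_derivative 1 / (y + x) ^ (n + 2)) (at x)" .
    show "0 \<le> 1 / (y + x) ^ (n + 2)" using \<open>y + x > 0\<close> by simp
  qed (use assms in simp_all)
  then show ?thesis by (simp add: diff_divide_distrib mult.commute)
qed

definition in_box :: "nat set \<Rightarrow> (nat \<Rightarrow> real) \<Rightarrow> (nat \<Rightarrow> ereal) \<Rightarrow> (nat \<Rightarrow> real) \<Rightarrow> bool" where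
  "in_box I l u x \<longleftrightarrow> (\<forall>i\<in>I. l i \<le> x i \<and> ereal (x i) \<le> u i)"

text \<open>The offset \<open>s\<close> stands for the coordinates already fixed by the recursion of
  \<open>corner_sum\<close>; the exponent \<open>m\<close> is free because each integration lowers
  it by one.\<close>

definition box_kernel :: "nat set \<Rightarrow> (nat \<Rightarrow> real) \<Rightarrow> (nat \<Rightarrow> ereal) \<Rightarrow> nat \<Rightarrow> real \<Rightarrow> (nat \<Rightarrow> real) \<Rightarrow> ennreal" where
  "box_kernel I l u m s x = (if in_box I l u x then ennreal (1 / (s + (\<Sum>i\<in>I. x i)) ^ m) else 0)"

lemma pred_in_box [measurable]: "finite I \<Longrightarrow> Measurable.pred (lebI I) (in_box I l u)"
  unfolding in_box_def by measurable

lemma measurable_box_kernel [measurable]: "finite I \<Longrightarrow> box_kernel I l u m s \<in> borel_measurable (lebI I)"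
  unfolding box_kernel_def by measurable

text \<open>The head coordinate is integrated first, inside the others: this lowers the exponent by one,
  to the one that the corner formula of the remaining coordinates needs, with \<open>s\<close> shifted by the
  lower or upper bound of the head.\<close>

lemma corner_integral:
  assumes "distinct js" "\<And>i. i \<in> set js \<Longrightarrow> ereal (l i) \<le> u i" "0 < s + (\<Sum>i\<in>set js. l i)"
  shows "(\<integral>\<^sup>+x. box_kernel (set js) l u (Suc (length js)) s x \<partial>lebI (set js))
      = ennreal (result (corner_sum s (map (\<lambda>i. (l i, u i)) js)) / fact (length js)) \<and>
    0 \<le> result (corner_sum s (map (\<lambda>i. (l i, u i)) js))"
  using assms
proof (induction js arbitrary: s)
  case Nil
  then show ?case
    by (simp add: leb.nn_integral_empty box_kernel_def in_box_def rdiv_def space_PiM_empty)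
next
  case (Cons i js)
  define I where "I = set js"
  define n where "n = length js"
  define B where "B s = result (corner_sum s (map (\<lambda>i. (l i, u i)) js))" for s
  have iI: "i \<notin> I" "finite I" using Cons.prems by (auto simp: I_def)
  have lu: "ereal (l i) \<le> u i" using Cons.prems by auto
  have pos: "0 < (s + l i) + (\<Sum>j\<in>I. l j)" using Cons.prems iI by (simp add: I_def)
  have IH: "(\<integral>\<^sup>+x. box_kernel I l u (Suc n) r x \<partial>lebI I) = ennreal (B r / fact n)" "0 \<le> B r"
    if "s + l i \<le> r" for r
    using Cons.IH[of r] Cons.prems pos that by (auto simp: I_def n_def B_def)
  define K where "K = (\<integral>\<^sup>+x. box_kernel (insert i I) l u (n + 2) s x \<partial>lebI (insert i I))"
  have K: "K = (\<integral>\<^sup>+x. (\<integral>\<^sup>+y. box_kernel (insert i I) l u (n + 2) s (x(i := y)) \<partial>lborel) \<partial>lebI I)"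
    unfolding K_def using iI by (intro leb.product_nn_integral_insert) auto
  \<comment> \<open>The lower corner minimises the denominator, so its positivity there carries over
    to the whole box.\<close>
  have ge: "(\<Sum>j\<in>I. l j) \<le> (\<Sum>j\<in>I. x j)" if "in_box I l u x" for x
    using that by (intro sum_mono) (auto simp: in_box_def)
  have upd: "box_kernel (insert i I) l u (n + 2) s (x(i := y)) = 
     (if in_box I l u x then ennreal (1 / ((s + (\<Sum>j\<in>I. x j)) + y) ^ (n + 2)) * indicator {t. l i \<le> t \<and> ereal t \<le> u i} y else 0)"
    for x y
  proof -
    have "(\<Sum>j\<in>I. (x(i := y)) j) = (\<Sum>j\<in>I. x j)"
      using iI by (intro sum.cong) auto
    moreover have "in_box (insert i I) l u (x(i := y)) \<longleftrightarrow> in_box I l u x \<and> l i \<le> y \<and> ereal y \<le> u i"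
      using iI by (auto simp: in_box_def)
    ultimately show ?thesis
      using iI by (simp add: box_kernel_def add_ac)
  qed
  have "K = ennreal (result (corner_sum s (map (\<lambda>i. (l i, u i)) (i # js))) / fact (Suc n)) \<and>
    0 \<le> result (corner_sum s (map (\<lambda>i. (l i, u i)) (i # js)))"
  proof (cases "u i")
    case PInf
    have "K = (\<integral>\<^sup>+x. ennreal (1 / real (n + 1)) * box_kernel I l u (Suc n) (s + l i) x \<partial>lebI I)"
      unfolding K upd
    proof (rule nn_integral_cong)
      fix x
      show "(\<integral>\<^sup>+y. (if in_box I l u x then ennreal (1 / ((s + (\<Sum>j\<in>I. x j)) + y) ^ (n + 2)) * indicator {t. l i \<le> t \<and> ereal t \<le> u i} y else 0) \<partial>lborel)
         = ennreal (1 / real (n + 1)) * box_kernel I l u (Suc n) (s + l i) x"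
      proof (cases "in_box I l u x")
        case True
        have "{t. l i \<le> t \<and> ereal t \<le> u i} = {l i..}" using PInf by auto
        with nn_integral_inverse_power_atLeast[of "s + (\<Sum>j\<in>I. x j)" "l i" n] ge[OF True] pos True
        show ?thesis by (simp add: box_kernel_def ennreal_mult'[symmetric] add_ac mult_ac)
      qed (simp add: box_kernel_def)
    qed
    also have "\<dots> = ennreal (1 / real (n + 1)) * ennreal (B (s + l i) / fact n)"
      using iI by (subst nn_integral_cmult) (auto simp: IH)
    also have "\<dots> = ennreal (B (s + l i) / fact (Suc n))"
      using IH(2) by (simp add: ennreal_mult'[symmetric] mult_ac)
    finally show ?thesis
      using PInf IH(2) by (simp add: B_def radd_def)
  next
    case MInf
    then show ?thesis using lu by simp
  next
    case (real r)
    then have lr: "l i \<le> r" using lu by simp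
    define G where "G x = (if in_box I l u x then ennreal ((1 / (s + (\<Sum>j\<in>I. x j) + l i) ^ (n + 1)
        - 1 / (s + (\<Sum>j\<in>I. x j) + r) ^ (n + 1)) / real (n + 1)) else 0)" for x
    have G [measurable]: "G \<in> borel_measurable (lebI I)"
      using iI unfolding G_def by measurable
    have KG: "K = (\<integral>\<^sup>+x. G x \<partial>lebI I)"
      unfolding K upd
    proof (rule nn_integral_cong)
      fix x
      show "(\<integral>\<^sup>+y. (if in_box I l u x then ennreal (1 / ((s + (\<Sum>j\<in>I. x j)) + y) ^ (n + 2)) * indicator {t. l i \<le> t \<and> ereal t \<le> u i} y else 0) \<partial>lborel)
         = G x"
      proof (cases "in_box I l u x")
        case True
        have "{t. l i \<le> t \<and> ereal t \<le> u i} = {l i..r}" using real by auto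
        with nn_integral_inverse_power_Icc[of "s + (\<Sum>j\<in>I. x j)" "l i" r n] ge[OF True] pos lr True
        show ?thesis by (simp add: G_def)
      qed (simp add: G_def)
    qed
    \<comment> \<open>The term of the upper bound is moved to the left, so that no subtraction
      occurs in \<open>ennreal\<close>; it is undone over the reals once \<open>K\<close> is known
      to be finite.\<close>
    have "ennreal (real (n + 1)) * K + ennreal (B (s + r) / fact n)
        = (\<integral>\<^sup>+x. ennreal (real (n + 1)) * G x + box_kernel I l u (Suc n) (s + r) x \<partial>lebI I)"
      unfolding KG using iI lr by (simp add: nn_integral_add nn_integral_cmult IH)
    also have "\<dots> = (\<integral>\<^sup>+x. box_kernel I l u (Suc n) (s + l i) x \<partial>lebI I)"
    proof (rule nn_integral_cong)
      fix x
      show "ennreal (real (n + 1)) * G x + box_kernel I l u (Suc n) (s + r) x = box_kernel I l u (Suc n) (s + l i) x"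
      proof (cases "in_box I l u x")
        case True
        define a b where "a = s + (\<Sum>j\<in>I. x j) + l i" and "b = s + (\<Sum>j\<in>I. x j) + r"
        have ab: "0 < a" "a \<le> b" using ge[OF True] pos lr by (auto simp: a_def b_def)
        then have "1 / b ^ (n + 1) \<le> 1 / a ^ (n + 1)"
          by (intro divide_left_mono power_mono mult_pos_pos) auto
        moreover have "0 \<le> 1 / b ^ (n + 1)" using ab by simp
        ultimately have "ennreal (real (n + 1)) * ennreal ((1 / a ^ (n + 1) - 1 / b ^ (n + 1)) / real (n + 1)) + ennreal (1 / b ^ (n + 1))
          = ennreal (1 / a ^ (n + 1))"
          by (simp add: ennreal_mult'[symmetric] ennreal_plus[symmetric] del: ennreal_plus)
        then show ?thesis using True by (simp add: G_def box_kernel_def a_def b_def add_ac)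
      qed (simp add: G_def box_kernel_def)
    qed
    also have "\<dots> = ennreal (B (s + l i) / fact n)"
      by (simp add: IH)
    finally have eq: "ennreal (real (n + 1)) * K + ennreal (B (s + r) / fact n) = ennreal (B (s + l i) / fact n)" .
    have "K \<noteq> top" 
      using eq by (auto simp: ennreal_mult_top)
    then obtain k where k: "K = ennreal k" "0 \<le> k" by (cases K) auto
    have B0: "0 \<le> B (s + r)" "0 \<le> B (s + l i)" using IH(2) lr by auto
    have "real (n + 1) * k + B (s + r) / fact n = B (s + l i) / fact n"
      using eq k B0 by (simp add: ennreal_mult'[symmetric] ennreal_plus[symmetric] del: ennreal_plus)
    then have kf: "k * fact (Suc n) = B (s + l i) - B (s + r)"
      by (simp add: field_simps)
    then have "k = (B (s + l i) - B (s + r)) / fact (Suc n)"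
      by (simp add: nonzero_eq_divide_eq del: fact_Suc)
    \<comment> \<open>The sign of the alternating corner sum is read off from the integral that it
      equals.\<close>
    moreover have "0 \<le> k * fact (Suc n)"
      using k(2) by (intro mult_nonneg_nonneg) auto
    then have "0 \<le> B (s + l i) - B (s + r)"
      by (simp only: kf)
    moreover have "result (corner_sum s (map (\<lambda>i. (l i, u i)) (i # js))) = B (s + l i) - B (s + r)"
      using real by (simp add: B_def radd_def rsub_def)
    ultimately show ?thesis
      using k(1) by (simp only:)
  qed
  moreover have "set (i # js) = insert i I" "Suc (length (i # js)) = n + 2" "length (i # js) = Suc n"
    by (simp_all add: I_def n_def)
  ultimately show ?case by (simp only: K_def)
qed

text \<open>An interval is the half-line from its lower end minus the half-line from its upper end.
  The split passes through the prefix \<open>X\<close> because every branch there only takes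
  differences, and it is a formal identity, valid also with the default value of
  \<open>1 / 0\<close>.\<close>

lemma corner_sum_split:
  "result (corner_sum s (X @ (l, ereal r) # Y)) =
   result (corner_sum s (X @ (l, \<infinity>) # Y)) - result (corner_sum s (X @ (r, \<infinity>) # Y))"
proof (induction X arbitrary: s)
  case (Cons b X)
  obtain l u where "b = (l, u)" by force
  with Cons show ?case by (cases u) (auto simp: arith_comp_defs)
qed (auto simp: arith_comp_defs)

text \<open>With \<open>Z\<close> the part of \<open>Q\<close> below the cuts, the full corner sums telescope along \<open>V\<close> to
  \<open>Q\<close> minus \<open>Z\<close>; the two kinds of corners kept by the cancelled evaluation telescope along \<open>T\<close> and \<open>S\<close>
  to the lowest corner minus \<open>Z\<close> and the lowest corner minus \<open>Q\<close>. The identity is formal, so it does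
  not matter that the term of the lowest corner may be the junk value of \<open>1 / 0\<close>.\<close>

lemma sum_slab_cancelled:
  assumes len: "length Q = N" and fin: "\<And>i. i < N \<Longrightarrow> \<exists>r. snd (Q ! i) = ereal r"
  shows "(\<Sum>k<N. result (slab_integral_cancelled c k (slab m Q k)))
    = (\<Sum>k<N. result (slab_integral_full c k (slab m Q k)))"
proof -
  define cs where "cs C = result (corner_sum 0 C)" for C
  define Z where "Z = map (\<lambda>i. (fst (Q ! i), ereal (m ! i))) [0..<N]"
  define V where "V k = cs (take k Z @ drop k Q)" for k
  define T where "T k = cs (take k Z @ only_lower (drop k Q))" for k
  define S where "S k = cs (only_lower (take k Q) @ drop k Q)" for k
  have [simp]: "length Z = N" by (simp add: Z_def)
  \<comment> \<open>At their ends the three sequences meet, hence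
    \<open>(T 0 - T N) - (S N - S 0) = V 0 - V N\<close>.\<close>
  have T_N: "T N = V N" "S N = T 0" "S 0 = V 0"
    using len by (simp_all add: T_def V_def S_def only_lower_def)
  have full: "result (slab_integral_full c k (slab m Q k)) = c * (V k - V (Suc k))"
    and canc: "result (slab_integral_cancelled c k (slab m Q k)) =
      c * ((T k - T (Suc k)) - (S (Suc k) - S k))" if k: "k < N" for k
  proof -
    \<comment> \<open>Finiteness matters: \<open>real_of_ereal\<close> would send an infinite upper
      bound to 0 and create a spurious corner.\<close>
    obtain l r where Qk: "Q ! k = (l, ereal r)" using fin[OF k] by (metis prod.collapse)
    let ?X = "take k Z" and ?Y = "drop (Suc k) Q"
    have dQ: "drop k Q = (l, ereal r) # ?Y" using k len by (simp add: Cons_nth_drop_Suc[symmetric] Qk)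
    have tZ: "take (Suc k) Z = ?X @ [(l, ereal (m ! k))]"
      using k len by (simp add: take_Suc_conv_app_nth Z_def Qk)
    have tQ: "take (Suc k) Q = take k Q @ [(l, ereal r)]"
      using k len by (simp add: take_Suc_conv_app_nth Qk)
    have slab: "slab m Q k = ?X @ (m ! k, ereal r) # ?Y"
      using k len
      by (intro nth_equalityI) (auto simp: slab_def Z_def nth_append nth_Cons' Qk)
    have lX: "length ?X = k" using k by simp
    have oX: "only_lower ?X = only_lower (take k Q)"
      using k len by (intro nth_equalityI) (auto simp: only_lower_def Z_def split: prod.splits)
    have oc: "only_lower ((a, b) # C) = (a, \<infinity>) # only_lower C"
      and oa: "only_lower (C @ D) = only_lower C @ only_lower D" for a b C D
      by (simp_all add: only_lower_def)
    have V: "V k = cs (?X @ (l, ereal r) # ?Y)" "V (Suc k) = cs (?X @ (l, ereal (m ! k)) # ?Y)"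
      by (simp_all add: V_def tZ dQ)
    have T: "T k = cs (?X @ (l, \<infinity>) # only_lower ?Y)"
       "T (Suc k) = cs (?X @ (l, ereal (m ! k)) # only_lower ?Y)"
      by (simp_all add: T_def tZ dQ oc)
    have S: "S k = cs (only_lower (take k Q) @ (l, ereal r) # ?Y)"
       "S (Suc k) = cs (only_lower (take k Q) @ (l, \<infinity>) # ?Y)"
      by (simp_all add: S_def tQ dQ oc oa) (simp add: only_lower_def)
    note split = corner_sum_split[of 0, folded cs_def]
    show "result (slab_integral_full c k (slab m Q k)) = c * (V k - V (Suc k))"
      by (simp add: slab_integral_full_def box_integral cs_def[symmetric] slab V split)
    have "result (slab_integral_cancelled c k (slab m Q k)) =
      c * (cs (take k (slab m Q k) @ only_lower (drop k (slab m Q k)))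
        - cs (only_lower (take k (slab m Q k)) @ (real_of_ereal (snd (slab m Q k ! k)), \<infinity>) # drop (Suc k) (slab m Q k)))"
      by (simp add: slab_integral_cancelled_def arith_comp_defs cs_def)
    moreover have "take k (slab m Q k) = ?X" "drop k (slab m Q k) = (m ! k, ereal r) # ?Y"
      "slab m Q k ! k = (m ! k, ereal r)" "drop (Suc k) (slab m Q k) = ?Y"
      using k len by (simp_all add: slab nth_append)
    ultimately have "result (slab_integral_cancelled c k (slab m Q k)) =
      c * (cs (?X @ (m ! k, \<infinity>) # only_lower ?Y) - cs (only_lower (take k Q) @ (r, \<infinity>) # ?Y))"
      by (simp add: oX oc)
    also have "\<dots> = c * ((T k - T (Suc k)) - (S (Suc k) - S k))"
      unfolding T S split[of "?X" l "m ! k"] split[of "only_lower (take k Q)" l r] by simp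
    finally show "result (slab_integral_cancelled c k (slab m Q k)) = c * ((T k - T (Suc k)) - (S (Suc k) - S k))" .
  qed
  have "(\<Sum>k<N. result (slab_integral_full c k (slab m Q k))) = c * (V 0 - V N)"
    using full by (simp add: sum_distrib_left[symmetric] sum_lessThan_telescope')
  moreover have "(\<Sum>k<N. result (slab_integral_cancelled c k (slab m Q k))) = c * ((T 0 - T N) - (S N - S 0))"
    using canc by (simp add: sum_distrib_left[symmetric] sum_subtractf[of _ _ "{..<N}"] sum_lessThan_telescope' sum_lessThan_telescope
        del: sum_subtractf)
  ultimately show ?thesis by (simp add: T_N)
qed

section \<open>Simplex coordinates\<close>

text \<open>Induction over the coordinates with the one-dimensional substitution. The restriction to
  \<open>I\<close> keeps the scaled point in the space of the product measure.\<close>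

lemma nn_integral_lebI_scale:
  assumes "finite I" "0 < t" "f \<in> borel_measurable (lebI I)"
  shows "(\<integral>\<^sup>+x. f x \<partial>lebI I) = ennreal (t ^ card I) * (\<integral>\<^sup>+x. f (\<lambda>i\<in>I. t * x i) \<partial>lebI I)"
  using assms(1,3)
proof (induction I arbitrary: f rule: finite_induct)
  case empty
  then show ?case by (simp add: leb.nn_integral_empty space_PiM_empty restrict_def)
next
  case (insert i I)
  note [measurable] = insert.prems
  have [simp]: "finite I" "i \<notin> I" by fact+
  interpret P: sigma_finite_measure "lebI I" by (rule leb.sigma_finite) simp
  have 1: "(\<lambda>y. \<integral>\<^sup>+x. f (x(i := y)) \<partial>lebI I) \<in> borel_measurable borel"
    by measurable
  have up: "(\<lambda>j\<in>I. t * x j)(i := t * y) = (\<lambda>j\<in>insert i I. t * (x(i := y)) j)" for x y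
    by (auto simp: fun_eq_iff)
  have "(\<integral>\<^sup>+x. f x \<partial>lebI (insert i I)) = (\<integral>\<^sup>+y. (\<integral>\<^sup>+x. f (x(i := y)) \<partial>lebI I) \<partial>lborel)"
    by (intro leb.product_nn_integral_insert_rev) auto
  also have "\<dots> = ennreal t * (\<integral>\<^sup>+y. (\<integral>\<^sup>+x. f (x(i := t * y)) \<partial>lebI I) \<partial>lborel)"
    using nn_integral_real_affine[OF 1, of t 0] \<open>0 < t\<close> by simp
  also have "(\<integral>\<^sup>+y. (\<integral>\<^sup>+x. f (x(i := t * y)) \<partial>lebI I) \<partial>lborel)
     = (\<integral>\<^sup>+y. ennreal (t ^ card I) * (\<integral>\<^sup>+x. f ((\<lambda>j\<in>I. t * x j)(i := t * y)) \<partial>lebI I) \<partial>lborel)"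
    by (intro nn_integral_cong insert.IH) measurable
  also have "\<dots> = ennreal (t ^ card I) * (\<integral>\<^sup>+y. (\<integral>\<^sup>+x. f (\<lambda>j\<in>insert i I. t * (x(i := y)) j) \<partial>lebI I) \<partial>lborel)"
    unfolding up by (intro nn_integral_cmult) measurable
  also have "(\<integral>\<^sup>+y. (\<integral>\<^sup>+x. f (\<lambda>j\<in>insert i I. t * (x(i := y)) j) \<partial>lebI I) \<partial>lborel)
     = (\<integral>\<^sup>+x. f (\<lambda>j\<in>insert i I. t * x j) \<partial>lebI (insert i I))"
    by (intro leb.product_nn_integral_insert_rev[symmetric]) auto
  also have "ennreal t * (ennreal (t ^ card I) * c) = ennreal (t ^ card (insert i I)) * c" for c
    using \<open>0 < t\<close> by (simp add: ennreal_mult mult.assoc)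
  finally show ?case .
qed

text \<open>No Jacobian is needed: translate the last coordinate so that it becomes the sum \<open>t\<close> of all
  coordinates, exchange the integrals, and scale the remaining coordinates by \<open>t\<close>.\<close>

lemma nn_integral_simplex_coords:
  assumes [measurable]: "h \<in> borel_measurable (lebI {..<Suc n})"
    and supp: "\<And>x. (\<Sum>i<Suc n. x i) \<le> 0 \<Longrightarrow> h x = 0"
  shows "(\<integral>\<^sup>+x. h x \<partial>lebI {..<Suc n}) = (\<integral>\<^sup>+w. (\<integral>\<^sup>+t. ennreal (t ^ n) *
      h (\<lambda>i\<in>{..<Suc n}. t * (w(n := 1 - (\<Sum>i<n. w i))) i) * indicator {0<..} t \<partial>lborel) \<partial>lebI {..<n})"
proof -
  define I where "I = {..<n}"
  have I: "{..<Suc n} = insert n I" "finite I" "n \<notin> I" by (auto simp: I_def)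
  note [measurable] = assms(1)[unfolded I(1)]
  interpret P: sigma_finite_measure "lebI I" by (rule leb.sigma_finite) (rule I)
  interpret PP: pair_sigma_finite "lebI I" lborel ..
  have upd: "(\<lambda>z. h ((f z)(n := g z))) \<in> borel_measurable Q"
    if "f \<in> measurable Q (lebI I)" "g \<in> borel_measurable Q" for f g and Q :: "'q measure"
    using that I(1) by (intro measurable_compose[OF measurable_fun_upd[of _ I] assms(1)]) auto
  have scale: "(\<lambda>z. \<lambda>i\<in>I. snd z * fst z i) \<in> measurable (lebI I \<Otimes>\<^sub>M lborel) (lebI I)"
    by (intro measurable_restrict) auto
  have sumI: "(\<Sum>i\<in>insert n I. (x(n := y)) i) = (\<Sum>i\<in>I. x i) + y" for x y
  proof -
    have "(\<Sum>i\<in>I. (x(n := y)) i) = (\<Sum>i\<in>I. x i)"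
      using I by (intro sum.cong) auto
    then show ?thesis using I by (simp add: add.commute)
  qed
  have "(\<integral>\<^sup>+x. h x \<partial>lebI (insert n I)) = (\<integral>\<^sup>+x. (\<integral>\<^sup>+y. h (x(n := y)) \<partial>lborel) \<partial>lebI I)"
    using I by (intro leb.product_nn_integral_insert) auto
  also have "\<dots> = (\<integral>\<^sup>+x. (\<integral>\<^sup>+t. h (x(n := t - (\<Sum>i\<in>I. x i))) \<partial>lborel) \<partial>lebI I)"
  proof (rule nn_integral_cong)
    fix x assume "x \<in> space (lebI I)"
    then have "(\<lambda>y. h (x(n := y))) \<in> borel_measurable borel"
      using measurable_compose[OF measurable_component_update assms(1)[unfolded I(1)]] I by auto
    from nn_integral_real_affine[OF this, of 1 "- (\<Sum>i\<in>I. x i)"]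
    show "(\<integral>\<^sup>+y. h (x(n := y)) \<partial>lborel) = (\<integral>\<^sup>+t. h (x(n := t - (\<Sum>i\<in>I. x i))) \<partial>lborel)"
      by simp
  qed
  also have "\<dots> = (\<integral>\<^sup>+t. (\<integral>\<^sup>+x. h (x(n := t - (\<Sum>i\<in>I. x i))) \<partial>lebI I) \<partial>lborel)"
    unfolding case_prod_beta' by (intro PP.Fubini'[symmetric]) (auto simp: case_prod_beta' intro!: upd)
  also have "\<dots> = (\<integral>\<^sup>+t. (\<integral>\<^sup>+w. ennreal (t ^ n) * h ((\<lambda>i\<in>I. t * w i)(n := t - (\<Sum>i\<in>I. t * w i))) * indicator {0<..} t \<partial>lebI I) \<partial>lborel)"
  proof (rule nn_integral_cong)
    fix t :: real
    show "(\<integral>\<^sup>+x. h (x(n := t - (\<Sum>i\<in>I. x i))) \<partial>lebI I)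
      = (\<integral>\<^sup>+w. ennreal (t ^ n) * h ((\<lambda>i\<in>I. t * w i)(n := t - (\<Sum>i\<in>I. t * w i))) * indicator {0<..} t \<partial>lebI I)"
    proof (cases "t > 0")
      case True
      have m: "(\<lambda>x. h (x(n := t - (\<Sum>i\<in>I. x i)))) \<in> borel_measurable (lebI I)"
        by (intro upd) auto
      have "(\<lambda>w. h ((\<lambda>i\<in>I. t * w i)(n := t - (\<Sum>i\<in>I. t * w i)))) \<in> borel_measurable (lebI I)"
        by (intro upd measurable_restrict) auto
      moreover have "(\<Sum>i\<in>I. (\<lambda>i\<in>I. t * w i) i) = (\<Sum>i\<in>I. t * w i)" for w :: "nat \<Rightarrow> real"
        by (intro sum.cong) auto
      ultimately show ?thesis
        unfolding nn_integral_lebI_scale[OF I(2) True m] using True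
        by (simp only: indicator_simps greaterThan_iff mult_1_right nn_integral_cmult)
          (simp add: I_def)
    next
      \<comment> \<open>The coordinates of this point sum to \<open>t\<close>, so \<open>h\<close>
        vanishes at it by assumption.\<close>
      case False
      have "h (x(n := t - (\<Sum>i\<in>I. x i))) = 0" for x
      proof (rule supp)
        have "(\<Sum>i<Suc n. (x(n := t - (\<Sum>i\<in>I. x i))) i) = t"
          unfolding I(1) sumI by simp
        then show "(\<Sum>i<Suc n. (x(n := t - (\<Sum>i\<in>I. x i))) i) \<le> 0"
          using False by linarith
      qed
      then show ?thesis using False by simp
    qed
  qed
  also have "\<dots> = (\<integral>\<^sup>+w. (\<integral>\<^sup>+t. ennreal (t ^ n) * h ((\<lambda>i\<in>I. t * w i)(n := t - (\<Sum>i\<in>I. t * w i))) * indicator {0<..} t \<partial>lborel) \<partial>lebI I)"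
    by (intro PP.Fubini') (auto simp: case_prod_beta' intro!: borel_measurable_times_ennreal upd scale)
  also have "\<dots> = (\<integral>\<^sup>+w. (\<integral>\<^sup>+t. ennreal (t ^ n) * h (\<lambda>i\<in>insert n I. t * (w(n := 1 - (\<Sum>i\<in>I. w i))) i) * indicator {0<..} t \<partial>lborel) \<partial>lebI I)"
  proof -
    have "(\<lambda>i\<in>I. t * w i)(n := t - (\<Sum>i\<in>I. t * w i)) = (\<lambda>i\<in>insert n I. t * (w(n := 1 - (\<Sum>i\<in>I. w i))) i)" for t :: real and w
      using I(3) by (auto simp: fun_eq_iff right_diff_distrib sum_distrib_left)
    then show ?thesis by (simp only:)
  qed
  finally show ?thesis unfolding I(1) unfolding I_def .
qed

section \<open>Slab decompositions\<close>

text \<open>The slice is a product with a singleton as one factor. This lets all faces of boxes be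
  ignored, so that closed boxes with disjoint interiors act as a partition.\<close>

lemma AE_lebI_component_neq:
  assumes "finite I" "i \<in> I"
  shows "AE x in lebI I. x i \<noteq> c"
proof (rule AE_I)
  let ?A = "\<Pi>\<^sub>E j\<in>I. if j = i then {c} else UNIV"
  show "{x \<in> space (lebI I). \<not> x i \<noteq> c} \<subseteq> ?A"
    using assms by (auto simp: space_PiM PiE_def extensional_def)
  show "emeasure (lebI I) ?A = 0"
    using assms by (subst leb.emeasure_PiM) (auto intro!: prod_zero bexI[of _ i])
  show "?A \<in> sets (lebI I)"
    using assms by (intro sets_PiM_I_finite) auto
qed

text \<open>Off the faces and cuts, a point of the box outside the product of the intervals up to
  \<open>v i\<close> lies in exactly one slab, that of the first coordinate with
  \<open>v k < x k\<close>.\<close>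

lemma sum_indicator_slab:
  fixes l v m x :: "nat \<Rightarrow> real" and u :: "nat \<Rightarrow> ereal"
  assumes m: "\<And>i. i < N \<Longrightarrow> ereal (m i) = max (ereal (l i)) (min (u i) (ereal (v i)))"
    and x: "\<And>i. i < N \<Longrightarrow> x i \<noteq> l i \<and> x i \<noteq> v i \<and> ereal (x i) \<noteq> u i"
  shows "(\<Sum>k<N. if in_box {..<N} (l(k := m k)) (\<lambda>i. if i < k then ereal (m i) else u i) x then 1 else 0)
    = (if in_box {..<N} l u x \<and> \<not> (\<forall>i<N. x i \<le> v i) then 1 else (0::ennreal))"
proof -
  \<comment> \<open>Clamping the cut to the side does not change which points lie above or below it:
    when \<open>v i\<close> is outside the side, one part shrinks to an endpoint, and
    \<open>x\<close> avoids the endpoints.\<close>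
  have cut: "(m i \<le> x i \<and> ereal (x i) \<le> u i \<longleftrightarrow> l i \<le> x i \<and> ereal (x i) \<le> u i \<and> v i < x i) \<and>
      (l i \<le> x i \<and> x i \<le> m i \<longleftrightarrow> l i \<le> x i \<and> ereal (x i) \<le> u i \<and> x i < v i)"
    if i: "i < N" for i
  proof (cases "u i")
    case (real r)
    have "ereal (m i) = ereal (max (l i) (min r (v i)))"
      using m[OF i] unfolding real by (auto simp: max_def min_def)
    then have "m i = max (l i) (min r (v i))" by (simp only: ereal.inject)
    moreover have "x i \<noteq> l i" "x i \<noteq> v i" "x i \<noteq> r" using x[OF i] real by auto
    ultimately show ?thesis unfolding real ereal_less_eq by linarith
  next
    case PInf
    have "ereal (m i) = ereal (max (l i) (v i))"
      using m[OF i] unfolding PInf by (simp add: max_def)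
    then have "m i = max (l i) (v i)" by (simp only: ereal.inject)
    moreover have "x i \<noteq> l i" "x i \<noteq> v i" using x[OF i] by auto
    ultimately show ?thesis unfolding PInf by (simp add: max_def) linarith
  next
    case MInf
    have "m i = l i" using m[OF i] unfolding MInf by simp
    moreover have "x i \<noteq> l i" using x[OF i] by auto
    ultimately show ?thesis unfolding MInf by simp
  qed
  define in_slab where "in_slab k \<longleftrightarrow> in_box {..<N} (l(k := m k)) (\<lambda>i. if i < k then ereal (m i) else u i) x" for k
  have slab: "in_slab k \<longleftrightarrow> in_box {..<N} l u x \<and> v k < x k \<and> (\<forall>i<k. x i < v i)" if k: "k < N" for k
  proof -
    have "in_slab k \<longleftrightarrow> (\<forall>i<N. if i < k then l i \<le> x i \<and> x i \<le> m i
        else if i = k then m i \<le> x i \<and> ereal (x i) \<le> u i else l i \<le> x i \<and> ereal (x i) \<le> u i)"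
      by (auto simp: in_slab_def in_box_def)
    also have "\<dots> \<longleftrightarrow> (\<forall>i<N. (l i \<le> x i \<and> ereal (x i) \<le> u i) \<and> (i < k \<longrightarrow> x i < v i) \<and> (i = k \<longrightarrow> v i < x i))"
      using cut by (intro all_cong) auto
    also have "\<dots> \<longleftrightarrow> in_box {..<N} l u x \<and> v k < x k \<and> (\<forall>i<k. x i < v i)"
      using k by (auto simp: in_box_def)
    finally show ?thesis .
  qed
  have "(\<Sum>k<N. if in_slab k then 1 else 0)
    = (if in_box {..<N} l u x \<and> \<not> (\<forall>i<N. x i \<le> v i) then 1 else (0::ennreal))"
  proof (cases "in_box {..<N} l u x \<and> \<not> (\<forall>i<N. x i \<le> v i)")
    case True
    define k where "k = (LEAST i. i < N \<and> v i < x i)"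
    have "\<exists>i. i < N \<and> v i < x i" using True by (auto simp: not_le)
    from LeastI_ex[OF this] have k: "k < N" "v k < x k" by (auto simp: k_def)
    have least: "x i < v i" if "i < k" for i
    proof -
      have "\<not> (i < N \<and> v i < x i)" using not_less_Least that unfolding k_def by blast
      then show ?thesis using that k x[of i] by (auto simp: not_less)
    qed
    have "in_slab j \<longleftrightarrow> j = k" if "j < N" for j
      using slab[OF that] True least k(2) by (metis linorder_neqE_nat less_asym)
    then have "(\<Sum>k<N. if in_slab k then 1 else 0) = (\<Sum>j<N. if j = k then 1 else (0::ennreal))"
      by (intro sum.cong) auto
    then show ?thesis using True k by simp
  next
    case False
    then have "\<not> in_slab j" if "j < N" for j
      using slab[OF that] that by (auto simp: not_le)
    then show ?thesis using False by simp
  qed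
  then show ?thesis by (simp add: in_slab_def)
qed

definition weight :: "nat \<Rightarrow> (nat \<Rightarrow> real) \<Rightarrow> ennreal" where
  "weight N x = ennreal (1 / (\<Sum>i<N. x i) ^ Suc N)"

definition box_mem :: "box \<Rightarrow> (nat \<Rightarrow> real) \<Rightarrow> bool" where
  "box_mem C = in_box {..<length C} (\<lambda>i. fst (C ! i)) (\<lambda>i. snd (C ! i))"

lemma measurable_weight [measurable]: "weight N \<in> borel_measurable (lebI {..<N})"
  unfolding weight_def by measurable

lemma pred_box_mem [measurable]: "length C = N \<Longrightarrow> Measurable.pred (lebI {..<N}) (box_mem C)"
  unfolding box_mem_def by (auto intro: pred_in_box)

lemma nn_integral_box:
  assumes len: "length C = N" and le: "\<And>i. i < N \<Longrightarrow> ereal (fst (C ! i)) \<le> snd (C ! i)"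
    and pos: "0 < (\<Sum>i<N. fst (C ! i))"
  shows "(\<integral>\<^sup>+x. weight N x * (if box_mem C x then 1 else 0) \<partial>lebI {..<N})
      = ennreal (1 / fact N * result (corner_sum 0 C)) \<and>
    0 \<le> result (corner_sum 0 C)"
proof -
  have "map (\<lambda>i. (fst (C ! i), snd (C ! i))) [0..<N] = C"
    using len by (intro nth_equalityI) auto
  moreover have "weight N x * (if box_mem C x then 1 else 0) =
      box_kernel {..<N} (\<lambda>i. fst (C ! i)) (\<lambda>i. snd (C ! i)) (Suc N) 0 x" for x
    by (simp add: weight_def box_kernel_def box_mem_def len)
  ultimately show ?thesis
    using corner_integral[of "[0..<N]" "\<lambda>i. fst (C ! i)" "\<lambda>i. snd (C ! i)" 0] le pos
    by (simp add: atLeast0LessThan)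
qed

lemma AE_ereal_neq:
  assumes "i < N"
  shows "AE x in lebI {..<N}. ereal (x i) \<noteq> u"
proof -
  have "AE x in lebI {..<N}. x i \<noteq> real_of_ereal u"
    using assms by (intro AE_lebI_component_neq) auto
  then show ?thesis by eventually_elim auto
qed

text \<open>The slabs partition the set up to null sets, and the corner formula applies to each even
  if \<open>Q\<close> contains the origin: slab \<open>k\<close> has the positive lower bound
  \<open>m ! k\<close> in coordinate \<open>k\<close>. It serves both for the boxes of the
  decomposition and for the whole orthant.\<close>

lemma nn_integral_slabs:
  assumes len: "length Q = N" "length v = N" "length m = N"
    and Q: "\<And>i. i < N \<Longrightarrow> 0 \<le> fst (Q ! i) \<and> ereal (fst (Q ! i)) < snd (Q ! i)"
    and v: "\<And>i. i < N \<Longrightarrow> 0 < v ! i"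
    and m: "\<And>i. i < N \<Longrightarrow> ereal (m ! i) = max (ereal (fst (Q ! i))) (min (snd (Q ! i)) (ereal (v ! i)))"
  shows "(\<integral>\<^sup>+x. weight N x * (if box_mem Q x \<and> \<not> (\<forall>i<N. x i \<le> v ! i) then 1 else 0) \<partial>lebI {..<N})
      = ennreal (\<Sum>k<N. 1 / fact N * result (corner_sum 0 (slab m Q k)))"
    and "0 \<le> (\<Sum>k<N. 1 / fact N * result (corner_sum 0 (slab m Q k)))"
proof -
  let ?l = "\<lambda>i. fst (Q ! i)" and ?u = "\<lambda>i. snd (Q ! i)"
  have mem: "box_mem (slab m Q k) = in_box {..<N} (?l(k := m ! k)) (\<lambda>i. if i < k then ereal (m ! i) else ?u i)"
    if "k < N" for k
    using len that by (auto simp: box_mem_def in_box_def slab_def fun_eq_iff)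
  have ml: "fst (Q ! i) \<le> m ! i" "ereal (m ! i) \<le> snd (Q ! i)" "0 < m ! i" if "i < N" for i
  proof -
    have "ereal (fst (Q ! i)) \<le> ereal (m ! i)" unfolding m[OF that] by simp
    then show "fst (Q ! i) \<le> m ! i" by simp
    show "ereal (m ! i) \<le> snd (Q ! i)" unfolding m[OF that] using Q[OF that] by (simp add: less_imp_le)
    have "ereal 0 \<le> ereal (fst (Q ! i))" using Q[OF that] by simp
    then have "ereal 0 < snd (Q ! i)" using Q[OF that] le_less_trans by blast
    then have "ereal 0 < ereal (m ! i)" unfolding m[OF that] using v[OF that] by (simp add: less_max_iff_disj)
    then show "0 < m ! i" by simp
  qed
  have slab: "(\<integral>\<^sup>+x. weight N x * (if box_mem (slab m Q k) x then 1 else 0) \<partial>lebI {..<N})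
      = ennreal (1 / fact N * result (corner_sum 0 (slab m Q k)))" 
      "0 \<le> 1 / fact N * result (corner_sum 0 (slab m Q k))" if k: "k < N" for k
  proof -
    have s: "fst (slab m Q k ! i) = (if i = k then m ! k else fst (Q ! i))"
        "snd (slab m Q k ! i) = (if i < k then ereal (m ! i) else snd (Q ! i))" if "i < N" for i
      using that len by (auto simp: slab_def)
    have "0 < fst (slab m Q k ! k)" using s k ml by simp
    also have "\<dots> \<le> (\<Sum>i<N. fst (slab m Q k ! i))"
      using k s Q ml(3) by (intro member_le_sum) (auto simp: less_imp_le)
    finally have "0 < (\<Sum>i<N. fst (slab m Q k ! i))" .
    moreover have "ereal (fst (slab m Q k ! i)) \<le> snd (slab m Q k ! i)" if "i < N" for i
      using s[OF that] ml[OF that] Q[OF that] by (auto simp: less_imp_le)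
    ultimately show "(\<integral>\<^sup>+x. weight N x * (if box_mem (slab m Q k) x then 1 else 0) \<partial>lebI {..<N})
      = ennreal (1 / fact N * result (corner_sum 0 (slab m Q k)))" 
      "0 \<le> 1 / fact N * result (corner_sum 0 (slab m Q k))"
      using nn_integral_box[of "slab m Q k" N] len by auto
  qed
  have "AE x in lebI {..<N}. \<forall>i\<in>{..<N}. x i \<noteq> ?l i \<and> x i \<noteq> v ! i \<and> ereal (x i) \<noteq> ?u i"
    by (intro AE_finite_allI finite_lessThan AE_conjI AE_lebI_component_neq AE_ereal_neq) auto
  then have AE: "AE x in lebI {..<N}. (\<Sum>k<N. if box_mem (slab m Q k) x then 1 else 0)
    = (if box_mem Q x \<and> \<not> (\<forall>i<N. x i \<le> v ! i) then 1 else (0::ennreal))"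
  proof eventually_elim
    case (elim x)
    then show ?case
      using sum_indicator_slab[of N "(!) m" ?l ?u "(!) v" x] m mem len by (simp add: box_mem_def)
  qed
  have "(\<integral>\<^sup>+x. weight N x * (if box_mem Q x \<and> \<not> (\<forall>i<N. x i \<le> v ! i) then 1 else 0) \<partial>lebI {..<N})
    = (\<integral>\<^sup>+x. (\<Sum>k<N. weight N x * (if box_mem (slab m Q k) x then 1 else 0)) \<partial>lebI {..<N})"
    by (rule nn_integral_cong_AE, use AE in eventually_elim) (simp add: sum_distrib_left[symmetric])
  also have "\<dots> = (\<Sum>k<N. \<integral>\<^sup>+x. weight N x * (if box_mem (slab m Q k) x then 1 else 0) \<partial>lebI {..<N})"
  proof (intro nn_integral_sum)
    fix k
    have [measurable]: "Measurable.pred (lebI {..<N}) (box_mem (slab m Q k))"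
      using len by (intro pred_box_mem) simp
    show "(\<lambda>x. weight N x * (if box_mem (slab m Q k) x then 1 else 0)) \<in> borel_measurable (lebI {..<N})"
      by measurable
  qed
  also have "\<dots> = (\<Sum>k<N. ennreal (1 / fact N * result (corner_sum 0 (slab m Q k))))"
    using slab(1) by (intro sum.cong) auto
  also have "\<dots> = ennreal (\<Sum>k<N. 1 / fact N * result (corner_sum 0 (slab m Q k)))"
    using slab(2) by (intro sum_ennreal) auto
  finally show "(\<integral>\<^sup>+x. weight N x * (if box_mem Q x \<and> \<not> (\<forall>i<N. x i \<le> v ! i) then 1 else 0) \<partial>lebI {..<N})
      = ennreal (\<Sum>k<N. 1 / fact N * result (corner_sum 0 (slab m Q k)))" .
  show "0 \<le> (\<Sum>k<N. 1 / fact N * result (corner_sum 0 (slab m Q k)))"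
    using slab(2) by (intro sum_nonneg) auto
qed

section \<open>The absolute integral as a weighted volume\<close>

lemma gmax_le_iff:
  assumes "length w = N" "N \<ge> 1"
  shows "gmax p w \<le> b \<longleftrightarrow> (\<forall>i<N. w ! i * p ! i \<le> b)"
  using assms unfolding gmax_def by (subst Max_le_iff) (auto simp: lessThan_empty_iff)

text \<open>Weights that sum to 1 cannot all be zero. This makes \<open>tau\<close> positive, hence
  \<open>1 / tau\<close> a genuine exit time of the ray.\<close>

lemma gmax_pos:
  assumes w: "w \<in> std_simplex N" and p: "p \<in> pos_points N" and N: "N \<ge> 1"
  shows "0 < gmax p w"
proof -
  have len: "length w = N" "length p = N" using w p by (auto simp: std_simplex_def pos_points_def)
  have "\<exists>i<N. 0 < w ! i"
  proof (rule ccontr)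
    assume "\<not> (\<exists>i<N. 0 < w ! i)"
    then have "sum_list w \<le> 0"
      by (intro sum_list_nonpos) (metis in_set_conv_nth len(1) not_less)
    then show False using w by (simp add: std_simplex_def)
  qed
  then obtain i where i: "i < N" "0 < w ! i" by auto
  then have "0 < w ! i * p ! i" using p len by (auto simp: pos_points_def)
  moreover have "w ! i * p ! i \<le> gmax p w" using gmax_le_iff[of w N p "gmax p w"] len N i by auto
  ultimately show ?thesis by linarith
qed

text \<open>This is the radial integral: after the powers of \<open>t\<close> combine,
  \<open>1 / t ^ 2\<close> remains. The open half-line differs from the closed one by a single null
  point.\<close>

lemma weight_ray_integral:
  assumes "0 < \<tau>"
  shows "(\<integral>\<^sup>+t. ennreal (1 / t ^ 2) * indicator {1 / \<tau> <..} t \<partial>lborel) = ennreal \<tau>"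
proof -
  have "(\<integral>\<^sup>+t. ennreal (1 / t ^ 2) * indicator {1 / \<tau> <..} t \<partial>lborel)
      = (\<integral>\<^sup>+t. ennreal (1 / (0 + t) ^ (0 + 2)) * indicator {1 / \<tau>..} t \<partial>lborel)"
    by (rule nn_integral_cong_AE, use AE_lborel_singleton[of "1 / \<tau>"] in eventually_elim)
      (auto simp: indicator_def power2_eq_square)
  also have "\<dots> = ennreal \<tau>"
    using assms by (subst nn_integral_inverse_power_atLeast) auto
  finally show ?thesis .
qed

text \<open>Stated with \<open>enn2real\<close>, so that integrability need not be settled here; the
  finiteness of the right-hand integral comes out in \<open>R2_eq\<close>.\<close>

lemma R2_eq_weight_integral:
  assumes N: "N \<ge> 1" and P: "finite P" "P \<noteq> {}" "P \<subseteq> pos_points N"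
  shows "R2 N P = enn2real (\<integral>\<^sup>+x. weight N x *
    (if (\<forall>i<N. 0 \<le> x i) \<and> \<not> (\<exists>p\<in>P. \<forall>i<N. x i \<le> 1 / p ! i) then 1 else 0) \<partial>lebI {..<N})"
proof -
  obtain n where n: "N = Suc n" using N by (cases N) auto
  define h where "h x = weight N x *
    (if (\<forall>i<N. 0 \<le> x i) \<and> \<not> (\<exists>p\<in>P. \<forall>i<N. x i \<le> 1 / p ! i) then 1 else 0)" for x
  define cc where "cc = complete_coords N"
  have len_cc [simp]: "length (cc w) = N" for w by (simp add: cc_def complete_coords_def n)
  have cc_nth: "cc w ! i = (w(n := 1 - (\<Sum>i<n. w i))) i" if "i < N" for w i
    using that by (auto simp: cc_def complete_coords_def n nth_append less_Suc_eq)
  have Ppos: "0 < p ! i" if "p \<in> P" "i < N" for p i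
    using that P by (auto simp: pos_points_def subset_iff)
  have [measurable]: "(\<lambda>w. cc w ! i) \<in> borel_measurable (lebI {..<n})" if "i < N" for i
    using that by (cases "i = n") (auto simp: cc_nth n)
  have cc_simplex: "cc w \<in> std_simplex N \<longleftrightarrow> (\<forall>i<N. 0 \<le> cc w ! i)" for w
  proof -
    have "sum_list (cc w) = 1"
      by (simp add: cc_def complete_coords_def n sum_list_distinct_conv_sum_set atLeast0LessThan)
    then show ?thesis by (auto simp: std_simplex_def all_set_conv_all_nth)
  qed
  have tau_le: "tau P w \<le> b \<longleftrightarrow> (\<exists>p\<in>P. gmax p w \<le> b)" for w b
    unfolding tau_def using P by (subst Min_le_iff) auto
  have tau_pos: "0 < tau P (cc w)" if "cc w \<in> std_simplex N" for w
    unfolding tau_def using P gmax_pos[OF that _ N] by (subst Min_gr_iff) auto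
  have hm: "h \<in> borel_measurable (lebI {..<Suc n})"
    unfolding h_def n using P(1) by measurable
  \<comment> \<open>In the orthant only the origin has a sum of at most 0, and it lies below every
    reciprocal point.\<close>
  have supp: "h x = 0" if "(\<Sum>i<Suc n. x i) \<le> 0" for x
  proof (cases "\<forall>i<N. 0 \<le> x i")
    case True
    have "\<forall>i\<in>{..<N}. x i = 0"
      using True that by (subst sum_nonneg_eq_0_iff[symmetric]) (auto simp: n[symmetric] intro: antisym sum_nonneg)
    then have "\<forall>p\<in>P. \<forall>i<N. x i \<le> 1 / p ! i" using Ppos by (auto simp: less_imp_le)
    then show ?thesis using P by (auto simp: h_def)
  qed (auto simp: h_def)
  have ray: "(\<integral>\<^sup>+t. ennreal (t ^ n) *
      h (\<lambda>i\<in>{..<Suc n}. t * (w(n := 1 - (\<Sum>i<n. w i))) i) * indicator {0<..} t \<partial>lborel)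
      = ennreal (indicator {v. cc v \<in> std_simplex N} w * tau P (cc w))" for w
  proof -
    have eq: "ennreal (t ^ n) *
      h (\<lambda>i\<in>{..<Suc n}. t * (w(n := 1 - (\<Sum>i<n. w i))) i) * indicator {0<..} t
      = (if cc w \<in> std_simplex N then ennreal (1 / t ^ 2) * indicator {1 / tau P (cc w) <..} t else 0)" for t
    proof (cases "t > 0")
      case True
      let ?x = "\<lambda>i\<in>{..<Suc n}. t * (w(n := 1 - (\<Sum>i<n. w i))) i"
      have x: "?x i = t * cc w ! i" if "i < N" for i using that by (simp add: cc_nth n)
      have "(\<Sum>i<N. ?x i) = t * (\<Sum>i<N. cc w ! i)"
        using x by (simp add: sum_distrib_left)
      also have "(\<Sum>i<N. cc w ! i) = 1"
        using cc_nth by (simp add: n)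
      finally have sum: "weight N ?x = ennreal (1 / t ^ Suc N)" by (simp add: weight_def)
      have nonneg: "(\<forall>i<N. 0 \<le> ?x i) \<longleftrightarrow> cc w \<in> std_simplex N"
        using x True by (auto simp: cc_simplex zero_le_mult_iff)
      have le: "?x i \<le> 1 / p ! i \<longleftrightarrow> cc w ! i * p ! i \<le> 1 / t" if "p \<in> P" "i < N" for p i
        using x[OF that(2)] Ppos[OF that] True by (simp add: field_simps)
      \<comment> \<open>Clearing denominators in the box condition gives
        \<open>gmax p (cc w) \<le> 1 / t\<close>, and some \<open>p\<close> satisfies it exactly if
        the minimum does.\<close>
      have U: "(\<exists>p\<in>P. \<forall>i<N. ?x i \<le> 1 / p ! i) \<longleftrightarrow> tau P (cc w) \<le> 1 / t"
        unfolding tau_le using le by (simp add: gmax_le_iff[OF len_cc N])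
      show ?thesis
      proof (cases "cc w \<in> std_simplex N")
        case simplex: True
        have "tau P (cc w) \<le> 1 / t \<longleftrightarrow> \<not> 1 / tau P (cc w) < t"
          using tau_pos[OF simplex] True by (auto simp: field_simps)
        moreover have "ennreal (t ^ n) * ennreal (1 / t ^ Suc N) = ennreal (1 / t ^ 2)"
          using True by (simp add: ennreal_mult'[symmetric] n power2_eq_square)
        ultimately show ?thesis
          using simplex True unfolding h_def nonneg U sum by (simp add: indicator_def mult.assoc[symmetric])
      next
        case False
        then show ?thesis unfolding h_def nonneg by simp
      qed
    next
      case False
      then have "\<not> 1 / tau P (cc w) < t" if "cc w \<in> std_simplex N"
        using tau_pos[OF that] by (auto simp: not_less intro: order_trans[of t 0])
      then show ?thesis using False by auto
    qed
    show ?thesis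
      unfolding eq using weight_ray_integral[OF tau_pos, of w] by (cases "cc w \<in> std_simplex N") simp_all
  qed
  have "(\<integral>\<^sup>+x. h x \<partial>lebI {..<N}) = (\<integral>\<^sup>+w. ennreal (indicator {v. cc v \<in> std_simplex N} w * tau P (cc w)) \<partial>lebI {..<n})"
    unfolding n using nn_integral_simplex_coords[OF hm supp] ray by (simp add: n)
  moreover have "R2 N P = integral\<^sup>L (lebI {..<n}) (\<lambda>w. indicator {v. cc v \<in> std_simplex N} w * tau P (cc w))"
    by (simp add: R2_def set_lebesgue_integral_def n cc_def)
  moreover have "\<dots> = enn2real (\<integral>\<^sup>+w. ennreal (indicator {v. cc v \<in> std_simplex N} w * tau P (cc w)) \<partial>lebI {..<n})"
  proof (rule integral_eq_nn_integral)
    have "(\<lambda>w. tau P (cc w)) \<in> borel_measurable (lebI {..<n})"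
      unfolding tau_def gmax_def using P(1) by (auto intro!: borel_measurable_Min borel_measurable_Max)
    moreover have "Measurable.pred (lebI {..<n}) (\<lambda>w. \<forall>i\<in>{..<N}. 0 \<le> cc w ! i)"
      by (intro pred_intros_finite) auto
    then have "Measurable.pred (lebI {..<n}) (\<lambda>w. cc w \<in> std_simplex N)"
      by (simp add: cc_simplex Ball_def)
    ultimately show "(\<lambda>w. indicator {v. cc v \<in> std_simplex N} w * tau P (cc w)) \<in> borel_measurable (lebI {..<n})"
      by (simp add: indicator_def)
    show "AE w in lebI {..<n}. 0 \<le> indicator {v. cc v \<in> std_simplex N} w * tau P (cc w)"
      using tau_pos by (auto simp: indicator_def less_imp_le)
  qed
  ultimately show ?thesis by (simp add: h_def)
qed

section \<open>The perspective algorithm on a decomposition\<close>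

lemma box_mem_iff: "length C = N \<Longrightarrow> map x [0..<N] \<in> box_set C \<longleftrightarrow> box_mem C x"
  by (auto simp: box_set_def box_mem_def in_box_def)

lemma mem_lower_union_iff:
  assumes "P \<subseteq> pos_points N"
  shows "x \<in> lower_union (recip ` P) \<longleftrightarrow>
    length x = N \<and> (\<forall>i<N. 0 \<le> x ! i) \<and> (\<exists>p\<in>P. \<forall>i<N. x ! i \<le> 1 / p ! i)"
proof -
  have "length p = N" if "p \<in> P" for p using that assms by (auto simp: pos_points_def)
  then show ?thesis unfolding lower_union_def recip_def by auto
qed

text \<open>The computation skips the minimum at an infinite upper bound, which is right for
  \<infinity>; the strict inequality excludes the other infinite value.\<close>

lemma cuts_nth:
  assumes "length u = length Q" "i < length Q" "ereal (fst (Q ! i)) < snd (Q ! i)"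
  shows "ereal (result (cuts u Q) ! i) = max (ereal (fst (Q ! i))) (min (snd (Q ! i)) (ereal (u ! i)))"
proof -
  obtain l h where "Q ! i = (l, h)" by force
  then show ?thesis
    using assms by (cases h) (auto simp: cuts_def arith_comp_defs)
qed

lemma result_perspective:
  "result (perspective S dec N P a) =
    (\<Sum>k<N. 1 / fact N * result (corner_sum 0 (outer_box (recip a) k))) -
    (\<Sum>Q\<leftarrow>fst (dec P). \<Sum>k<N. result (S (1 / fact N) k (slab (result (cuts (recip a) Q)) Q k)))"
proof -
  have u: "map (\<lambda>x. result (rdiv 1 x)) a = recip a"
    by (simp add: recip_def rdiv_def)
  have inner: "result (fold_comp (\<lambda>k J. return (C k) \<rhd> (\<lambda>B. F k B) \<rhd> (\<lambda>x. radd J x)) [0..<N] I)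
     = I + (\<Sum>k<N. result (F k (C k)))" for I F and C :: "nat \<Rightarrow> box"
    by (subst result_fold_comp_add[where g = "\<lambda>k. result (F k (C k))"])
      (auto simp: radd_def sum_list_distinct_conv_sum_set atLeast0LessThan)
  have outer: "result (fold_comp (\<lambda>Q I. cuts v Q \<rhd> (\<lambda>m.
         fold_comp (\<lambda>k J. return (slab m Q k) \<rhd> (\<lambda>C. S c k C) \<rhd> (\<lambda>x. radd J x)) [0..<N] I)) D 0)
     = 0 + (\<Sum>Q\<leftarrow>D. \<Sum>k<N. result (S c k (slab (result (cuts v Q)) Q k)))" for v c D
    by (rule result_fold_comp_add) (simp add: inner)
  show ?thesis
    unfolding perspective_def result_bind result_map_comp u inv_fact call_routine_def comp.sel inner outer
    by (simp add: rsub_def box_integral)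
qed

section \<open>Correctness and bounds for one valid input\<close>

locale perspective_instance =
  fixes N :: nat and P :: "point set" and a :: point and dec :: routine
  assumes input: "perspective_input N P a dec"
begin

abbreviation D :: "box list" where "D \<equiv> fst (dec P)"

lemma N: "N \<ge> 1"
  and P: "finite P" "P \<noteq> {}" "P \<subseteq> pos_points N"
  and length_a: "length a = N"
  and a: "i < N \<Longrightarrow> 0 < a ! i" "p \<in> P \<Longrightarrow> i < N \<Longrightarrow> p ! i \<le> a ! i"
  using input by (auto simp: perspective_input_def pos_points_def)

lemma P_pos: "p \<in> P \<Longrightarrow> i < N \<Longrightarrow> 0 < p ! i"
  using P by (auto simp: pos_points_def subset_iff)

lemma decomp: "box_decomposition N (lower_union (recip ` P)) D"
  using input by (simp add: perspective_input_def)

lemma length_D: "Q \<in> set D \<Longrightarrow> length Q = N"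
  using decomp by (simp add: box_decomposition_def)

lemma box_set_D: "Q \<in> set D \<Longrightarrow> x \<in> box_set Q \<Longrightarrow> x \<in> lower_union (recip ` P)"
  using decomp by (auto simp: box_decomposition_def)

lemma D_less: "Q \<in> set D \<Longrightarrow> i < N \<Longrightarrow> ereal (fst (Q ! i)) < snd (Q ! i)"
  using decomp length_D[of Q] unfolding box_decomposition_def
  by (metis (no_types, lifting) case_prodD nth_mem prod.collapse)

text \<open>Each box lies in the lower union, which is nonnegative and bounded: test it on the lower
  corner, and on a point pushed far along a side supposed infinite.\<close>

lemma D_bounds:
  assumes Q: "Q \<in> set D" and i: "i < N"
  shows "0 \<le> fst (Q ! i)" "\<exists>r. snd (Q ! i) = ereal r"
proof -
  have "map fst Q \<in> box_set Q"
    using D_less[OF Q] length_D[OF Q] by (auto simp: box_set_def less_imp_le)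
  then have "map fst Q \<in> lower_union (recip ` P)" by (rule box_set_D[OF Q])
  then show "0 \<le> fst (Q ! i)"
    using i length_D[OF Q] by (auto simp: mem_lower_union_iff[OF P(3)])
  show "\<exists>r. snd (Q ! i) = ereal r"
  proof (rule ccontr)
    assume "\<nexists>r. snd (Q ! i) = ereal r"
    then have inf: "snd (Q ! i) = \<infinity>"
      using D_less[OF Q i] by (cases "snd (Q ! i)") auto
    \<comment> \<open>A sum of positive terms dominates each of them, so \<open>b + 1\<close>
      exceeds every bound of the union in coordinate \<open>i\<close>.\<close>
    define b where "b = (\<Sum>p\<in>P. 1 / p ! i)"
    have b: "1 / p ! i \<le> b" if "p \<in> P" for p
      unfolding b_def using that P(1) P_pos[OF _ i] by (intro member_le_sum) (auto simp: less_imp_le)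
    define y where "y = (map fst Q)[i := max (fst (Q ! i)) (b + 1)]"
    have y: "length y = N" "y ! j = (if j = i then max (fst (Q ! i)) (b + 1) else fst (Q ! j))" if "j < N" for j
      using that length_D[OF Q] by (auto simp: y_def nth_list_update)
    have "y \<in> box_set Q"
      using D_less[OF Q] length_D[OF Q] y inf i by (auto simp: box_set_def less_imp_le)
    then have "y \<in> lower_union (recip ` P)" by (rule box_set_D[OF Q])
    then obtain p where "p \<in> P" "y ! i \<le> 1 / p ! i"
      using i by (auto simp: mem_lower_union_iff[OF P(3)])
    then show False using b[of p] y(2)[OF i] by simp
  qed
qed

text \<open>The origin has to be covered. Terms that depend on \<open>N\<close> alone can therefore
  be charged to the boxes.\<close>

lemma D_nonempty: "length D \<ge> 1"
proof -
  have "replicate N 0 \<in> lower_union (recip ` P)"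
    using P P_pos by (fastforce simp: mem_lower_union_iff[OF P(3)] less_imp_le)
  then have "D \<noteq> []" using decomp by (auto simp: box_decomposition_def)
  then show ?thesis by (cases D) auto
qed

abbreviation nonneg :: "(nat \<Rightarrow> real) \<Rightarrow> bool" where
  "nonneg x \<equiv> \<forall>i<N. 0 \<le> x i"

abbreviation in_A :: "(nat \<Rightarrow> real) \<Rightarrow> bool" where
  "in_A x \<equiv> \<forall>i<N. x i \<le> recip a ! i"

abbreviation in_U :: "(nat \<Rightarrow> real) \<Rightarrow> bool" where
  "in_U x \<equiv> \<exists>p\<in>P. \<forall>i<N. x i \<le> 1 / p ! i"

lemma length_recip_a: "length (recip a) = N"
  by (simp add: recip_def length_a)

text \<open>The dominance of \<open>a\<close> over \<open>P\<close> enters here: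
  \<open>1 / a ! i\<close> is at most \<open>1 / p ! i\<close> for any chosen
  \<open>p\<close>.\<close>

lemma in_A_imp_in_U: "in_A x \<Longrightarrow> in_U x"
proof -
  assume A: "in_A x"
  obtain p where p: "p \<in> P" using P by auto
  have "x i \<le> 1 / p ! i" if "i < N" for i
  proof -
    have "x i \<le> 1 / a ! i" using A that length_a by (simp add: recip_def)
    also have "\<dots> \<le> 1 / p ! i" using P_pos[OF p that] a(2)[OF p that] by (simp add: frac_le)
    finally show ?thesis .
  qed
  then show ?thesis using p by auto
qed

lemma nonneg_in_U_iff: "nonneg x \<and> in_U x \<longleftrightarrow> (\<exists>j<length D. box_mem (D ! j) x)"
proof -
  have "nonneg x \<and> in_U x \<longleftrightarrow> map x [0..<N] \<in> lower_union (recip ` P)"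
    by (auto simp: mem_lower_union_iff[OF P(3)])
  also have "\<dots> \<longleftrightarrow> (\<exists>Q\<in>set D. map x [0..<N] \<in> box_set Q)"
    using decomp by (auto simp: box_decomposition_def)
  also have "\<dots> \<longleftrightarrow> (\<exists>Q\<in>set D. box_mem Q x)"
    using box_mem_iff length_D by blast
  also have "\<dots> \<longleftrightarrow> (\<exists>j<length D. box_mem (D ! j) x)"
    by (metis in_set_conv_nth)
  finally show ?thesis .
qed

text \<open>The complement of A splits into the complement of the union and the parts of the boxes
  outside A. Off the faces, each point of the union lies in the interior of its boxes, hence in only
  one.\<close>

lemma AE_indicator_complement:
  "AE x in lebI {..<N}. (if nonneg x \<and> \<not> in_A x then 1 else (0::ennreal)) =
     (if nonneg x \<and> \<not> in_U x then 1 else 0) + (\<Sum>j<length D. if box_mem (D ! j) x \<and> \<not> in_A x then 1 else 0)"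
proof -
  have "AE x in lebI {..<N}. \<forall>j\<in>{..<length D}. \<forall>i\<in>{..<N}. x i \<noteq> fst (D ! j ! i) \<and> ereal (x i) \<noteq> snd (D ! j ! i)"
    by (intro AE_finite_allI finite_lessThan AE_conjI AE_lebI_component_neq AE_ereal_neq) auto
  then show ?thesis
  proof eventually_elim
    case (elim x)
    have interior: "map x [0..<N] \<in> box_interior (D ! j)" if "j < length D" "box_mem (D ! j) x" for j
    proof -
      have len: "length (D ! j) = N" using that length_D by auto
      have "fst (D ! j ! i) < x i \<and> ereal (x i) < snd (D ! j ! i)" if i: "i < N" for i
      proof -
        have "x i \<noteq> fst (D ! j ! i)" "ereal (x i) \<noteq> snd (D ! j ! i)"
          using elim i \<open>j < length D\<close> by blast+
        then show ?thesis
          using \<open>box_mem (D ! j) x\<close> i by (simp add: box_mem_def in_box_def len less_le)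
      qed
      then show ?thesis by (simp add: box_interior_def len)
    qed
    have unique: "j = k" if "j < length D" "k < length D" "box_mem (D ! j) x" "box_mem (D ! k) x" for j k
      using interior[of j] interior[of k] that decomp unfolding box_decomposition_def by blast
    show ?case
    proof (cases "nonneg x \<and> in_U x")
      case True
      then obtain j where j: "j < length D" "box_mem (D ! j) x" using nonneg_in_U_iff[of x] by auto
      then have "(\<Sum>k<length D. if box_mem (D ! k) x \<and> \<not> in_A x then 1 else 0)
        = (\<Sum>k<length D. if k = j then (if in_A x then 0 else 1) else (0::ennreal))"
        using unique by (intro sum.cong) auto
      then show ?thesis using True j(1) by simp
    next
      case False
      then have "\<not> box_mem (D ! j) x" if "j < length D" for j
        using nonneg_in_U_iff[of x] that by auto
      then have "(\<Sum>k<length D. if box_mem (D ! k) x \<and> \<not> in_A x then 1 else 0) = (0::ennreal)"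
        by simp
      moreover have "nonneg x \<and> \<not> in_A x \<longleftrightarrow> nonneg x \<and> \<not> in_U x"
        using False in_A_imp_in_U[of x] by blast
      ultimately show ?thesis by (simp only: add_0_right)
    qed
  qed
qed

lemma R2_eq:
  "R2 N P = (\<Sum>k<N. 1 / fact N * result (corner_sum 0 (outer_box (recip a) k))) -
    (\<Sum>Q\<leftarrow>D. \<Sum>k<N. 1 / fact N * result (corner_sum 0 (slab (result (cuts (recip a) Q)) Q k)))"
    (is "_ = ?Ra - ?I")
proof -
  let ?m = "\<lambda>Q. result (cuts (recip a) Q)"
  let ?s = "\<lambda>Q. \<Sum>k<N. 1 / fact N * result (corner_sum 0 (slab (?m Q) Q k))"
  define X where "X = (\<integral>\<^sup>+x. weight N x * (if nonneg x \<and> \<not> in_U x then 1 else 0) \<partial>lebI {..<N})"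
  have a_pos: "0 < recip a ! i" if "i < N" for i
    using a(1) that length_a by (simp add: recip_def)
  \<comment> \<open>The outer boxes are the slabs of the orthant with the cuts
    \<open>recip a\<close>, so one slab lemma covers both sums.\<close>
  define orthant :: box where "orthant = replicate N (0, \<infinity>)"
  have outer: "outer_box (recip a) k = slab (recip a) orthant k" if "k < N" for k
    using that length_recip_a by (intro nth_equalityI) (auto simp: outer_box_def slab_def orthant_def)
  have Ra: "(\<integral>\<^sup>+x. weight N x * (if nonneg x \<and> \<not> in_A x then 1 else 0) \<partial>lebI {..<N}) = ennreal ?Ra" "0 \<le> ?Ra"
  proof -
    have "box_mem orthant = nonneg" by (auto simp: box_mem_def in_box_def orthant_def fun_eq_iff)
    moreover have "length orthant = N" by (simp add: orthant_def)
    moreover have "0 \<le> fst (orthant ! i) \<and> ereal (fst (orthant ! i)) < snd (orthant ! i)"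
      "ereal (recip a ! i) = max (ereal (fst (orthant ! i))) (min (snd (orthant ! i)) (ereal (recip a ! i)))"
      if "i < N" for i
      using that a_pos[OF that] by (auto simp: orthant_def max_def)
    ultimately show "(\<integral>\<^sup>+x. weight N x * (if nonneg x \<and> \<not> in_A x then 1 else 0) \<partial>lebI {..<N}) = ennreal ?Ra"
      "0 \<le> ?Ra"
      using nn_integral_slabs[of orthant N "recip a" "recip a"] a_pos length_recip_a outer by auto
  qed
  have box: "(\<integral>\<^sup>+x. weight N x * (if box_mem Q x \<and> \<not> in_A x then 1 else 0) \<partial>lebI {..<N}) = ennreal (?s Q)"
    "0 \<le> ?s Q" if Q: "Q \<in> set D" for Q
  proof -
    have len: "length Q = N" "length (?m Q) = N" using length_D[OF Q] length_recip_a by simp_all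
    have bounds: "0 \<le> fst (Q ! i) \<and> ereal (fst (Q ! i)) < snd (Q ! i)"
      "ereal (?m Q ! i) = max (ereal (fst (Q ! i))) (min (snd (Q ! i)) (ereal (recip a ! i)))" if "i < N" for i
      using D_bounds(1)[OF Q that] D_less[OF Q that] cuts_nth[of "recip a" Q i] len length_recip_a that by auto
    show "(\<integral>\<^sup>+x. weight N x * (if box_mem Q x \<and> \<not> in_A x then 1 else 0) \<partial>lebI {..<N}) = ennreal (?s Q)"
      using nn_integral_slabs(1)[OF len(1) length_recip_a len(2) bounds(1) a_pos bounds(2)] .
    show "0 \<le> ?s Q"
      using nn_integral_slabs(2)[OF len(1) length_recip_a len(2) bounds(1) a_pos bounds(2)] .
  qed
  have ind: "(\<lambda>x. weight N x * (if p x then 1 else 0)) \<in> borel_measurable (lebI {..<N})"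
    if [measurable]: "Measurable.pred (lebI {..<N}) p" for p
    by measurable
  have A: "Measurable.pred (lebI {..<N}) in_A"
  proof -
    have "Measurable.pred (lebI {..<N}) (\<lambda>x. \<forall>i\<in>{..<N}. x i \<le> recip a ! i)" by measurable
    then show ?thesis by (simp only: Ball_def lessThan_iff)
  qed
  have box_meas: "(\<lambda>x. weight N x * (if box_mem (D ! j) x \<and> \<not> in_A x then 1 else 0)) \<in> borel_measurable (lebI {..<N})"
    if "j \<in> {..<length D}" for j
    using that length_D A by (intro ind pred_intros_logic pred_box_mem) auto
  have U_meas: "(\<lambda>x. weight N x * (if nonneg x \<and> \<not> in_U x then 1 else 0)) \<in> borel_measurable (lebI {..<N})"
  proof (rule ind)
    have "Measurable.pred (lebI {..<N}) (\<lambda>x. (\<forall>i\<in>{..<N}. 0 \<le> x i) \<and> \<not> (\<exists>p\<in>P. \<forall>i\<in>{..<N}. x i \<le> 1 / p ! i))"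
      using P(1) by measurable
    then show "Measurable.pred (lebI {..<N}) (\<lambda>x. nonneg x \<and> \<not> in_U x)"
      by (simp only: Ball_def lessThan_iff)
  qed
  have "ennreal ?Ra = (\<integral>\<^sup>+x. weight N x * (if nonneg x \<and> \<not> in_U x then 1 else 0) +
     (\<Sum>j<length D. weight N x * (if box_mem (D ! j) x \<and> \<not> in_A x then 1 else 0)) \<partial>lebI {..<N})"
    unfolding Ra(1)[symmetric]
    by (rule nn_integral_cong_AE, use AE_indicator_complement in eventually_elim)
      (simp only: distrib_left sum_distrib_left)
  also have "\<dots> = X + (\<integral>\<^sup>+x. (\<Sum>j<length D. weight N x * (if box_mem (D ! j) x \<and> \<not> in_A x then 1 else 0)) \<partial>lebI {..<N})"
    unfolding X_def by (intro nn_integral_add borel_measurable_sum U_meas box_meas)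
  also have "(\<integral>\<^sup>+x. (\<Sum>j<length D. weight N x * (if box_mem (D ! j) x \<and> \<not> in_A x then 1 else 0)) \<partial>lebI {..<N})
     = (\<Sum>j<length D. \<integral>\<^sup>+x. weight N x * (if box_mem (D ! j) x \<and> \<not> in_A x then 1 else 0) \<partial>lebI {..<N})"
    by (intro nn_integral_sum box_meas)
  also have "\<dots> = (\<Sum>j<length D. ennreal (?s (D ! j)))"
    using box(1) by (intro sum.cong) auto
  also have "\<dots> = ennreal (\<Sum>j<length D. ?s (D ! j))"
    using box(2) by (intro sum_ennreal) auto
  also have "(\<Sum>j<length D. ?s (D ! j)) = ?I"
    by (simp add: sum_list_sum_nth atLeast0LessThan)
  \<comment> \<open>Since the left side is finite, so is \<open>X\<close>, and the difference can be
    taken over the reals.\<close>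
  finally have eq: "ennreal ?Ra = X + ennreal ?I" .
  have "0 \<le> ?I" using box(2) by (intro sum_list_nonneg) auto
  moreover obtain x where x: "X = ennreal x" "0 \<le> x"
    using eq by (cases X) auto
  ultimately have "?Ra = x + ?I"
    using eq Ra(2) by (simp add: ennreal_plus[symmetric] del: ennreal_plus)
  moreover have "R2 N P = enn2real X"
    unfolding X_def by (rule R2_eq_weight_integral[OF N P])
  ultimately show ?thesis using x by simp
qed

text \<open>A single cancelled value is not the integral over its slab; the two evaluations are
  compared only after summing over the slabs of one box.\<close>

lemma result_eq_R2:
  assumes "S \<in> {slab_integral_full, slab_integral_cancelled}"
  shows "result (perspective S dec N P a) = R2 N P"
proof -
  have "(\<Sum>k<N. result (S (1 / fact N) k (slab m Q k))) = (\<Sum>k<N. 1 / fact N * result (corner_sum 0 (slab m Q k)))"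
    if "Q \<in> set D" for Q m
  proof -
    have "(\<Sum>k<N. result (S (1 / fact N) k (slab m Q k))) = (\<Sum>k<N. result (slab_integral_full (1 / fact N) k (slab m Q k)))"
      using assms sum_slab_cancelled[OF length_D D_bounds(2)] that by auto
    then show ?thesis by (simp add: slab_integral_full_def box_integral)
  qed
  then show ?thesis
    unfolding result_perspective R2_eq
    by (intro arg_cong2[where f = "(-)"] refl arg_cong[where f = sum_list] map_cong) auto
qed

lemma peak_le:
  assumes "S \<in> {slab_integral_full, slab_integral_cancelled}"
  shows "peak (perspective S dec N P a) \<le> 100 * (N * length D)"
proof (rule peak_perspective[OF length_a])
  show "peak (S c k (slab m Q k)) \<le> 10 * N + 10" if "length Q = N" "k < N" for Q m c k
    using assms slab_full_cost(2)[of c k "slab m Q k"] slab_cancelled_cost(2)[of k "slab m Q k" c] that by auto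
qed (use N D_nonempty length_D in auto)

lemma lower_order:
  "6 * 2 ^ N + 5 * N + 2 \<le> 8 * (2 ^ N * length D) + 5 * (N * length D)"
proof -
  have "2 ^ N * 1 \<le> 2 ^ N * length D" "N * 1 \<le> N * length D" "1 * 1 \<le> 2 ^ N * length D"
    using D_nonempty by (intro mult_le_mono; simp)+
  then show ?thesis by linarith
qed

text \<open>The coefficients add up to 8 + 11 for \<open>2 ^ N\<close> and 2 + 3 + 5 for
  \<open>N\<close>; 20 covers both.\<close>

lemma time_cancelled:
  "time (perspective slab_integral_cancelled dec N P a) \<le> snd (dec P) + 20 * (N * length D + 2 ^ N * length D)"
  using time_perspective[where dec = dec and P = P and S = slab_integral_cancelled and W = "11 * 2 ^ N + 3 * N",
      OF length_a length_D sum_slab_cancelled_time] lower_order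
  by (simp add: algebra_simps)

text \<open>The term \<open>N * 2 ^ N\<close> per box is not covered by the uniform bound, but it is
  a constant once \<open>N\<close> is fixed.\<close>

lemma time_full:
  "time (perspective slab_integral_full dec N P a) \<le> snd (dec P) + (20 * (N + 2 ^ N) + 4 * (N * 2 ^ N)) * length D"
proof -
  have "(\<Sum>k\<leftarrow>[0..<N]. time (slab_integral_full c k (slab m Q k)) + 1) \<le> N * (4 * 2 ^ N + 1)"
    if "length Q = N" for Q m c
  proof -
    have "(\<Sum>k\<leftarrow>[0..<N]. time (slab_integral_full c k (slab m Q k)) + 1) \<le> (\<Sum>k\<leftarrow>[0..<N]. 4 * 2 ^ N + 1)"
      using slab_full_cost(1)[of c _ "slab m Q _"] that by (intro sum_list_mono) auto
    then show ?thesis by (simp add: sum_list_triv)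
  qed
  from time_perspective[where dec = dec and P = P and S = slab_integral_full and W = "N * (4 * 2 ^ N + 1)", OF length_a length_D this] lower_order
  show ?thesis by (simp add: algebra_simps)
qed

end

theorem theorem5:
  shows
    "(\<exists>c::nat. \<forall>(N::nat) (P::point set) (a::point) (dec::routine)
          (T_decomp :: nat \<Rightarrow> nat \<Rightarrow> nat \<Rightarrow> nat) (n::nat) (M::nat).
        perspective_input N P a dec \<and> n = card P \<and> M = length (fst (dec P)) \<and>
        snd (dec P) \<le> T_decomp n M N \<longrightarrow>
          result (perspective slab_integral_cancelled dec N P a) = R2 N P \<and>
          time (perspective slab_integral_cancelled dec N P a)
            \<le> T_decomp n M N + c * (N * M + 2 ^ N * M) \<and>
          peak (perspective slab_integral_cancelled dec N P a) \<le> c * (N * M))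
     \<and>
     (\<forall>N::nat. \<exists>c::nat. \<forall>(P::point set) (a::point) (dec::routine)
          (T_decomp :: nat \<Rightarrow> nat \<Rightarrow> nat \<Rightarrow> nat) (n::nat) (M::nat).
        perspective_input N P a dec \<and> n = card P \<and> M = length (fst (dec P)) \<and>
        snd (dec P) \<le> T_decomp n M N \<longrightarrow>
        (\<forall>slab_integral \<in> {slab_integral_full, slab_integral_cancelled}.
          result (perspective slab_integral dec N P a) = R2 N P \<and>
          time (perspective slab_integral dec N P a) \<le> T_decomp n M N + c * M \<and>
          peak (perspective slab_integral dec N P a) \<le> c * M))"
proof (intro conjI allI)
  have inst: "perspective_instance N P a dec" if "perspective_input N P a dec" for N P a dec
    using that by unfold_locales
  note facts = perspective_instance.result_eq_R2 perspective_instance.peak_le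
    perspective_instance.time_cancelled perspective_instance.time_full
  note facts = facts[OF inst]
  show "\<exists>c::nat. \<forall>(N::nat) (P::point set) (a::point) (dec::routine)
          (T_decomp :: nat \<Rightarrow> nat \<Rightarrow> nat \<Rightarrow> nat) (n::nat) (M::nat).
        perspective_input N P a dec \<and> n = card P \<and> M = length (fst (dec P)) \<and>
        snd (dec P) \<le> T_decomp n M N \<longrightarrow>
          result (perspective slab_integral_cancelled dec N P a) = R2 N P \<and>
          time (perspective slab_integral_cancelled dec N P a)
            \<le> T_decomp n M N + c * (N * M + 2 ^ N * M) \<and>
          peak (perspective slab_integral_cancelled dec N P a) \<le> c * (N * M)"
  \<comment> \<open>The constant 100 is dictated by the space bound; the time needs only 20.\<close>
  proof (intro exI[of _ 100] allI impI conjI)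
    fix N P a dec n M and T_decomp :: "nat \<Rightarrow> nat \<Rightarrow> nat \<Rightarrow> nat"
    assume *: "perspective_input N P a dec \<and> n = card P \<and> M = length (fst (dec P)) \<and>
        snd (dec P) \<le> T_decomp n M N"
    then show "result (perspective slab_integral_cancelled dec N P a) = R2 N P"
      and "peak (perspective slab_integral_cancelled dec N P a) \<le> 100 * (N * M)"
      using facts(1,2) by auto
    show "time (perspective slab_integral_cancelled dec N P a) \<le> T_decomp n M N + 100 * (N * M + 2 ^ N * M)"
      using facts(3)[OF *[THEN conjunct1]] * by auto
  qed
  fix N :: nat
  show "\<exists>c::nat. \<forall>(P::point set) (a::point) (dec::routine)
          (T_decomp :: nat \<Rightarrow> nat \<Rightarrow> nat \<Rightarrow> nat) (n::nat) (M::nat).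
        perspective_input N P a dec \<and> n = card P \<and> M = length (fst (dec P)) \<and>
        snd (dec P) \<le> T_decomp n M N \<longrightarrow>
        (\<forall>slab_integral \<in> {slab_integral_full, slab_integral_cancelled}.
          result (perspective slab_integral dec N P a) = R2 N P \<and>
          time (perspective slab_integral dec N P a) \<le> T_decomp n M N + c * M \<and>
          peak (perspective slab_integral dec N P a) \<le> c * M)"
  \<comment> \<open>One constant for both evaluations: \<open>100 * N\<close> covers the space,
    \<open>4 * (N * 2 ^ N)\<close> the full corner formula on all slabs.\<close>
  proof (intro exI[of _ "100 * (N + 2 ^ N) + 4 * (N * 2 ^ N)"] allI impI ballI conjI)
    fix P a dec n M S and T_decomp :: "nat \<Rightarrow> nat \<Rightarrow> nat \<Rightarrow> nat"
    assume *: "perspective_input N P a dec \<and> n = card P \<and> M = length (fst (dec P)) \<and>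
        snd (dec P) \<le> T_decomp n M N" and S: "S \<in> {slab_integral_full, slab_integral_cancelled}"
    show "result (perspective S dec N P a) = R2 N P"
      using facts(1) * S by blast
    have "peak (perspective S dec N P a) \<le> 100 * (N * M)"
      using facts(2) * S by blast
    then show "peak (perspective S dec N P a) \<le> (100 * (N + 2 ^ N) + 4 * (N * 2 ^ N)) * M"
      by (simp add: algebra_simps)
    have "time (perspective S dec N P a) \<le> snd (dec P) + (20 * (N + 2 ^ N) + 4 * (N * 2 ^ N)) * M"
      using facts(3)[of N P a dec] facts(4)[of N P a dec] * S by (auto simp: algebra_simps)
    moreover have "(20 * (N + 2 ^ N) + 4 * (N * 2 ^ N)) * M \<le> (100 * (N + 2 ^ N) + 4 * (N * 2 ^ N)) * M"
      by (intro mult_le_mono1 add_mono) auto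
    moreover have "snd (dec P) \<le> T_decomp n M N" using * by blast
    ultimately show "time (perspective S dec N P a) \<le> T_decomp n M N + (100 * (N + 2 ^ N) + 4 * (N * 2 ^ N)) * M"
      by linarith
  qed
qed

end
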